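(* Let $\mathbb{U}$ be a space with distance function $d$, let $r>0$, $c>1$, let $R,S\subseteq\mathbb{U}$ and $N=|R|+|S|$ be sufficiently large, and let $M$, $B$ be the internal memory size and block size of the external memory model. Assume there exists a monotonic $(r,cr,p'_1,p'_2)$-sensitive family $\mathcal H'$ of functions with respect to $d$ with $p'_1=(M/N)^{\rho}$ and $p'_2=M/N$, for a suitable value $0<\rho<1$. Then with probability $1-1/N$, the algorithm ASimJoin (described in the context) enumerates all pairs $(x,y)\in R\times S$ with $d(x,y)\le r$ using $$\tilde O\!\left(\left(\frac{N}{M}\right)^{\rho}\left(\frac{N}{B}+\frac{|R\bowtie_{\le r}S|}{MB}\right)+\frac{|R\bowtie_{\le cr}S|}{MB}\right)\ \text{I/Os},$$ where $\tilde O(\cdot)$ hides factors polylogarithmic in $N$.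
   Context: For $t\ge0$, $R\bowtie_{\le t}S=\{(x,y)\in R\times S: d(x,y)\le t\}$. A family $\mathcal H$ is $(r,cr,p_1,p_2)$-sensitive if for uniformly random $h\in\mathcal H$ and all $x,y$: $d(x,y)\le r\Rightarrow \Pr[h(x)=h(y)]\ge p_1$ and $d(x,y)\ge cr\Rightarrow\Pr[h(x)=h(y)]\le p_2$; it is monotonic if $\Pr[h(x)=h(y)]$ is non-increasing in $d(x,y)$. External memory model: internal memory of $M$ points, unbounded external memory, transfers in blocks of $B$ points; I/O complexity counts block transfers. Enumerating a pair means calling emit$(x,y)$. A pair is near if $d(x,y)\le r$ and far if $d(x,y)>cr$. Algorithm ASimJoin$(R,S)$: Repeat $3\log N$ times: associate with each point of $R$ and $S$ a counter set to $0$; then repeat $L=2/p'_1$ times: choose $h'\in\mathcal H'$ uniformly at random; use $h'$ to partition (in place) $R$ and $S$ into buckets $R_v,S_v$ of points with hash value $v$; for each hash value $v$ (say $|R_v|\le|S_v|$, otherwise swap roles), split $R_v$ and $S_v$ into chunks of size at most $M/2$; for every chunk of $R_v$, load it into memory, and for every chunk of $S_v$, load it into memory, compute all pairs between the two loaded chunks, emit all near pairs, and for each far pair increment the counters of both its points by $1$; then remove from both chunks all points whose counter exceeds $8LM$ and write the chunk of $S_v$ back to external memory; after processing all chunks of $S_v$, write the chunk of $R_v$ back to external memory.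
   Formalization: Added: pairs at distance greater than r collide with probability at most p'_1 (p'_1 is the collision probability at r). Changed: points of the loaded chunk of R_v are removed only when it is written back, not after each chunk of S_v. Without either change the I/O bound fails. *)

theory Defs
  imports "HOL-Probability.Probability"
begin

definition distance_function :: "'a set \<Rightarrow> ('a \<Rightarrow> 'a \<Rightarrow> real) \<Rightarrow> bool" where
  "distance_function U d \<longleftrightarrow>
     (\<forall>x\<in>U. d x x = 0) \<and> (\<forall>x\<in>U. \<forall>y\<in>U. 0 \<le> d x y \<and> d x y = d y x)"

definition sim_join :: "('a \<Rightarrow> 'a \<Rightarrow> real) \<Rightarrow> real \<Rightarrow> 'a set \<Rightarrow> 'a set \<Rightarrow> ('a \<times> 'a) set" where
  "sim_join d t R S = {(x, y). x \<in> R \<and> y \<in> S \<and> d x y \<le> t}"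

definition collision_prob :: "('a \<Rightarrow> 'v) set \<Rightarrow> 'a \<Rightarrow> 'a \<Rightarrow> real" where
  "collision_prob H x y = measure_pmf.prob (pmf_of_set H) {h. h x = h y}"

definition sensitive ::
  "'a set \<Rightarrow> ('a \<Rightarrow> 'a \<Rightarrow> real) \<Rightarrow> ('a \<Rightarrow> 'v) set \<Rightarrow> real \<Rightarrow> real \<Rightarrow> real \<Rightarrow> real \<Rightarrow> bool" where
  "sensitive U d H r cr p1 p2 \<longleftrightarrow>
     (\<forall>x\<in>U. \<forall>y\<in>U.
        (d x y \<le> r \<longrightarrow> p1 \<le> collision_prob H x y) \<and>
        (cr \<le> d x y \<longrightarrow> collision_prob H x y \<le> p2))"

definition monotonic :: "'a set \<Rightarrow> ('a \<Rightarrow> 'a \<Rightarrow> real) \<Rightarrow> ('a \<Rightarrow> 'v) set \<Rightarrow> bool" where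
  "monotonic U d H \<longleftrightarrow>
     (\<forall>x\<in>U. \<forall>y\<in>U. \<forall>x'\<in>U. \<forall>y'\<in>U.
        d x y \<le> d x' y' \<longrightarrow> collision_prob H x' y' \<le> collision_prob H x y)"

text \<open>
  The parameter \<open>p1\<close> of a monotonic family is its collision probability at distance \<open>r\<close>, so that
  pairs at distance greater than \<open>r\<close> collide with probability at most \<open>p1\<close>. Sensitivity alone makes
  \<open>p1\<close> only a lower bound for the pairs at distance at most \<open>r\<close>: the family consisting of one
  constant function is monotonic, and sensitive for every \<open>p1 \<le> 1\<close> if no pair is at distance \<open>cr\<close> or
  more, but then all pairs at distance between \<open>r\<close> and \<open>cr\<close> are compared in every repetition.
\<close>

definition threshold_prob ::
  "'a set \<Rightarrow> ('a \<Rightarrow> 'a \<Rightarrow> real) \<Rightarrow> ('a \<Rightarrow> 'v) set \<Rightarrow> real \<Rightarrow> real \<Rightarrow> bool" where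
  "threshold_prob U d H r p1 \<longleftrightarrow> (\<forall>x\<in>U. \<forall>y\<in>U. r < d x y \<longrightarrow> collision_prob H x y \<le> p1)"


section \<open>External memory\<close>

text \<open>
  The two inputs live in external memory as arrays; position \<open>i\<close> of an array lies in its block
  \<open>i div B\<close>. Besides the loaded chunks, internal memory holds one block frame per array and
  direction, through which the blocks pass. A block that is still in the frame is not transferred
  again, so that a sequential scan over many small buckets costs one transfer per block and not one
  per bucket. A block entering a write frame is charged twice: it is fetched, since it may be
  overwritten only in part, and written.
\<close>

datatype arr = Arr_R | Arr_S
datatype dir = Read | Write

fun other :: "arr \<Rightarrow> arr" where
  "other Arr_R = Arr_S"
| "other Arr_S = Arr_R"

record 'a mach =
  frame :: "arr \<Rightarrow> dir \<Rightarrow> nat option"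
  ios :: nat
  emitted :: "('a \<times> 'a) set"

definition blocks :: "nat \<Rightarrow> nat \<Rightarrow> nat \<Rightarrow> nat set" where
  "blocks B a n = (\<lambda>i. i div B) ` {a..<a + n}"

fun dir_cost :: "dir \<Rightarrow> nat" where
  "dir_cost Read = 1"
| "dir_cost Write = 2"

definition transfer :: "nat \<Rightarrow> arr \<Rightarrow> dir \<Rightarrow> nat \<Rightarrow> nat \<Rightarrow> 'a mach \<Rightarrow> 'a mach" where
  "transfer B A D a n s =
     (if n = 0 then s
      else s\<lparr>frame := (frame s)(A := (frame s A)(D := Some ((a + n - 1) div B))),
             ios := ios s + dir_cost D * card (blocks B a n - set_option (frame s A D))\<rparr>)"

definition scan_cost :: "nat \<Rightarrow> dir \<Rightarrow> nat \<Rightarrow> nat \<Rightarrow> nat" where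
  "scan_cost B D a n = dir_cost D * card (blocks B a n)"

fun merge_key :: "('b \<Rightarrow> 'v::linorder) \<Rightarrow> 'b list \<Rightarrow> 'b list \<Rightarrow> 'b list" where
  "merge_key f [] ys = ys"
| "merge_key f xs [] = xs"
| "merge_key f (x # xs) (y # ys) =
     (if f x \<le> f y then x # merge_key f xs (y # ys) else y # merge_key f (x # xs) ys)"

text \<open>
  Binary external merge sort of the array segment that starts at position \<open>a\<close>, returning the sorted
  segment and the number of block transfers. A run that fits into memory is read, sorted internally
  and written; a merge reads the two sorted halves and writes the result.
\<close>

function ext_sort ::
  "nat \<Rightarrow> nat \<Rightarrow> ('b \<Rightarrow> 'v::linorder) \<Rightarrow> nat \<Rightarrow> 'b list \<Rightarrow> 'b list \<times> nat" where
  "ext_sort M B f a xs =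
     (if length xs \<le> max 1 M
      then (sort_key f xs, scan_cost B Read a (length xs) + scan_cost B Write a (length xs))
      else
        (let m = length xs div 2;
             (ys, i) = ext_sort M B f a (take m xs);
             (zs, j) = ext_sort M B f (a + m) (drop m xs)
         in (merge_key f ys zs,
             i + j + scan_cost B Read a m + scan_cost B Read (a + m) (length xs - m)
               + scan_cost B Write a (length xs))))"
  by pat_completeness auto
termination
  by (relation "Wellfounded.measure (\<lambda>(M, B, f, a, xs). length xs)") auto

declare ext_sort.simps [simp del]

function chunks :: "nat \<Rightarrow> 'b list \<Rightarrow> 'b list list" where
  "chunks k xs = (if xs = [] then [] else if k = 0 then [xs] else take k xs # chunks k (drop k xs))"
  by pat_completeness auto
termination
  by (relation "Wellfounded.measure (\<lambda>(k, xs). length xs)") auto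

declare chunks.simps [simp del]


section \<open>The algorithm\<close>

text \<open>An array entry is a point together with its counter.\<close>

type_synonym 'a item = "'a \<times> nat"

text \<open>Increase the counter of each entry \<open>x\<close> of \<open>X\<close> by the number of entries \<open>y\<close> of \<open>Y\<close> with \<open>P x y\<close>.\<close>

definition bump :: "('a \<Rightarrow> 'a \<Rightarrow> bool) \<Rightarrow> 'a item list \<Rightarrow> 'a item list \<Rightarrow> 'a item list" where
  "bump P X Y = map (\<lambda>(x, k). (x, k + length (filter (\<lambda>(y, _). P x y) Y))) X"

definition keep :: "nat \<Rightarrow> 'a item list \<Rightarrow> 'a item list" where
  "keep T X = filter (\<lambda>(x, k). \<not> k > T) X"

context
  fixes d :: "'a \<Rightarrow> 'a \<Rightarrow> real" and r c :: real and M B T :: nat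
begin

text \<open>
  \<open>A\<close> is the array playing the outer role (that of \<open>R\<close> in the description with \<open>|R_v| \<le> |S_v|\<close>);
  pairs are always oriented as elements of \<open>R \<times> S\<close>. \<open>T\<close> is the threshold \<open>8LM\<close>.
\<close>

definition orient :: "arr \<Rightarrow> 'a \<Rightarrow> 'a \<Rightarrow> 'a \<times> 'a" where
  "orient A x y = (if A = Arr_R then (x, y) else (y, x))"

definition near :: "'a \<times> 'a \<Rightarrow> bool" where
  "near p \<longleftrightarrow> d (fst p) (snd p) \<le> r"

definition far :: "'a \<times> 'a \<Rightarrow> bool" where
  "far p \<longleftrightarrow> d (fst p) (snd p) > c * r"

definition near_pairs :: "arr \<Rightarrow> 'a item list \<Rightarrow> 'a item list \<Rightarrow> ('a \<times> 'a) set" where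
  "near_pairs A X Y = {p. near p \<and> (\<exists>x \<in> fst ` set X. \<exists>y \<in> fst ` set Y. p = orient A x y)}"

text \<open>
  One pass of the loaded outer chunk \<open>X\<close> over the chunks of the inner bucket. The inner bucket is
  stored contiguously: chunks are read from position \<open>rd\<close> on, and what remains of them is written back
  contiguously from position \<open>wr\<close> on (always \<open>wr \<le> rd\<close>).

  Pairs are computed between the chunks as they were loaded. An inner chunk loses its removed points
  when it is written back, hence after each pair of chunks; the outer chunk is loaded once per pass and
  loses them when it is written back, at the end of the pass. (Were it shrunk during the pass, a few
  surviving points could force scans of the whole inner bucket that no counter pays for.)
\<close>

fun inner_pass ::
  "arr \<Rightarrow> nat \<Rightarrow> nat \<Rightarrow> 'a item list \<Rightarrow> 'a item list list \<Rightarrow> 'a mach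
     \<Rightarrow> 'a item list \<times> 'a item list list \<times> 'a mach" where
  "inner_pass A rd wr X [] s = (X, [], s)"
| "inner_pass A rd wr X (Y # Ys) s =
     (let s1 = transfer B (other A) Read rd (length Y) s;
          s2 = s1\<lparr>emitted := emitted s1 \<union> near_pairs A X Y\<rparr>;
          X' = bump (\<lambda>x y. far (orient A x y)) X Y;
          Y' = keep T (bump (\<lambda>y x. far (orient A x y)) Y X);
          s3 = transfer B (other A) Write wr (length Y') s2;
          (X'', Ys', s4) = inner_pass A (rd + length Y) (wr + length Y') X' Ys s3
      in (X'', Y' # Ys', s4))"

fun outer_pass ::
  "arr \<Rightarrow> nat \<Rightarrow> nat \<Rightarrow> nat \<Rightarrow> 'a item list list \<Rightarrow> 'a item list list \<Rightarrow> 'a mach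
     \<Rightarrow> 'a item list list \<times> 'a item list list \<times> 'a mach" where
  "outer_pass A rd wr b [] Ys s = ([], Ys, s)"
| "outer_pass A rd wr b (X # Xs) Ys s =
     (let s1 = transfer B A Read rd (length X) s;
          (X1, Ys1, s2) = inner_pass A b b X Ys s1;
          X' = keep T X1;
          s3 = transfer B A Write wr (length X') s2;
          (Xs', Ys2, s4) = outer_pass A (rd + length X) (wr + length X') b Xs Ys1 s3
      in (X' # Xs', Ys2, s4))"

definition join_bucket ::
  "nat \<Rightarrow> nat \<Rightarrow> 'a item list \<Rightarrow> 'a item list \<Rightarrow> 'a mach
     \<Rightarrow> 'a item list \<times> 'a item list \<times> 'a mach" where
  "join_bucket a b Rv Sv s =
     (let Rc = chunks (M div 2) Rv; Sc = chunks (M div 2) Sv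
      in if length Rv \<le> length Sv
         then (case outer_pass Arr_R a a b Rc Sc s of (Xs, Ys, s') \<Rightarrow> (concat Xs, concat Ys, s'))
         else (case outer_pass Arr_S b b a Sc Rc s of (Ys, Xs, s') \<Rightarrow> (concat Xs, concat Ys, s')))"

text \<open>
  \<open>Rs\<close> and \<open>Ss\<close> are sorted by hash value and the values are visited in increasing order, so the
  buckets are consecutive array segments; \<open>a\<close> and \<open>b\<close> are the start positions of the next ones.
\<close>

fun join_buckets ::
  "('a \<Rightarrow> 'v) \<Rightarrow> 'a item list \<Rightarrow> 'a item list \<Rightarrow> 'v list \<Rightarrow> nat \<Rightarrow> nat \<Rightarrow> 'a mach
     \<Rightarrow> 'a item list \<times> 'a item list \<times> 'a mach" where
  "join_buckets h Rs Ss [] a b s = ([], [], s)"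
| "join_buckets h Rs Ss (v # vs) a b s =
     (let Rv = filter (\<lambda>x. h (fst x) = v) Rs;
          Sv = filter (\<lambda>x. h (fst x) = v) Ss;
          (Rv', Sv', s1) = join_bucket a b Rv Sv s;
          (Rs', Ss', s2) = join_buckets h Rs Ss vs (a + length Rv) (b + length Sv) s1
      in (Rv' @ Rs', Sv' @ Ss', s2))"

text \<open>
  One inner repetition with hash function \<open>h\<close>. The last four costs are those of a scan that closes
  the gaps left in the two arrays by removed points.
\<close>

definition hash_join ::
  "('a \<Rightarrow> 'v::linorder) \<Rightarrow> 'a item list \<times> 'a item list \<times> 'a mach
     \<Rightarrow> 'a item list \<times> 'a item list \<times> 'a mach" where
  "hash_join h = (\<lambda>(Rs, Ss, s).
     (let (Rs1, i) = ext_sort M B (\<lambda>x. h (fst x)) 0 Rs;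
          (Ss1, j) = ext_sort M B (\<lambda>x. h (fst x)) 0 Ss;
          vs = sorted_list_of_set ((\<lambda>x. h (fst x)) ` (set Rs1 \<union> set Ss1));
          s1 = s\<lparr>frame := (\<lambda>_ _. None), ios := ios s + i + j\<rparr>;
          (Rs2, Ss2, s2) = join_buckets h Rs1 Ss1 vs 0 0 s1
      in (Rs2, Ss2,
          s2\<lparr>ios := ios s2
                + scan_cost B Read 0 (length Rs1) + scan_cost B Write 0 (length Rs2)
                + scan_cost B Read 0 (length Ss1) + scan_cost B Write 0 (length Ss2)\<rparr>)))"

end

fun repeat_pmf :: "nat \<Rightarrow> ('s \<Rightarrow> 's pmf) \<Rightarrow> 's \<Rightarrow> 's pmf" where
  "repeat_pmf 0 f s = return_pmf s"
| "repeat_pmf (Suc n) f s = bind_pmf (f s) (repeat_pmf n f)"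

text \<open>
  One outer repetition: fresh copies of the input arrays \<open>xs\<close>, \<open>ys\<close> with counters \<open>0\<close>, then \<open>L\<close>
  repetitions with independent uniformly random hash functions.
\<close>

definition asimjoin_round ::
  "('a \<Rightarrow> 'a \<Rightarrow> real) \<Rightarrow> real \<Rightarrow> real \<Rightarrow> nat \<Rightarrow> nat \<Rightarrow> ('a \<Rightarrow> 'v::linorder) set \<Rightarrow> nat
     \<Rightarrow> 'a list \<Rightarrow> 'a list \<Rightarrow> 'a mach \<Rightarrow> 'a mach pmf" where
  "asimjoin_round d r c M B H L xs ys s =
     map_pmf (\<lambda>(_, _, s'). s')
       (repeat_pmf L
          (\<lambda>st. map_pmf (\<lambda>h. hash_join d r c M B (8 * L * M) h st) (pmf_of_set H))
          (map (\<lambda>x. (x, 0)) xs, map (\<lambda>y. (y, 0)) ys,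
           s\<lparr>ios := ios s
                + scan_cost B Read 0 (length xs) + scan_cost B Write 0 (length xs)
                + scan_cost B Read 0 (length ys) + scan_cost B Write 0 (length ys)\<rparr>))"

definition asimjoin ::
  "('a \<Rightarrow> 'a \<Rightarrow> real) \<Rightarrow> real \<Rightarrow> real \<Rightarrow> nat \<Rightarrow> nat \<Rightarrow> ('a \<Rightarrow> 'v::linorder) set \<Rightarrow> real
     \<Rightarrow> 'a list \<Rightarrow> 'a list \<Rightarrow> 'a mach pmf" where
  "asimjoin d r c M B H p1 xs ys =
     repeat_pmf (nat \<lceil>3 * log 2 (real (length xs + length ys))\<rceil>)
       (asimjoin_round d r c M B H (nat \<lceil>2 / p1\<rceil>) xs ys)
       \<lparr>frame = (\<lambda>_ _. None), ios = 0, emitted = {}\<rparr>"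

end

theory Submission
  imports Defs
begin

text \<open>
  Correctness. In a round, a near pair is reported as soon as its points collide while both are still
  present. They never collide with probability at most \<open>(1 - p1)^L \<le> e^-2 \<le> 1/4\<close>. A point meets on average
  at most \<open>L * N * p2 = L * M\<close> far points per round, so by Markov's inequality its counter exceeds
  \<open>8 * L * M\<close> with probability at most \<open>1/8\<close>. Hence a round misses the pair with probability at most
  \<open>1/2\<close>, all \<open>3 log N\<close> rounds miss it with probability at most \<open>N^-3\<close>, and a union bound applies.

  Transfers. Apart from the last outer chunk of each bucket, whose pass is a step of one sequential scan
  of the array, a pass loads a full chunk, so the blocks it moves are paid for by the compared pairs,
  at \<open>1/(MB)\<close> each. Far pairs are charged to the counters of the inner points, which are at most
  \<open>8 * L * M + M / 2\<close>; near pairs are compared at most once per repetition. The number of compared pairs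
  with \<open>r < d \<le> c * r\<close>, divided by the number of all such pairs, is a sum of independent variables in
  \<open>[0,1]\<close> with total mean at most \<open>p1 * L * K = O(log N)\<close> over all \<open>K\<close> rounds, and an exponential moment
  bounds it by \<open>O(log N)\<close> with probability \<open>1 - N^-2\<close>.
\<close>

section \<open>Counting pairs and counters\<close>

text \<open>A run is adaptive: which points are still present when a function is drawn depends on
  all earlier functions. The proof separates the two. All functions can be drawn in advance, the run
  is then deterministic, and every run satisfies inequalities that mention the original input only:
  a counter grows by at most the collisions with all far points of the input, and the compared pairs
  that are not far are bounded by those of the input. The probabilistic part thus concerns sums over
  independent functions and no machine state. For the transfers the obstacle is rounding: one extra
  block per bucket could exceed N / B by far when buckets are small, so costs are measured through
  frame positions and no bucket is charged separately. The inequalities are multiplied by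
  \<open>m * B\<close>, where \<open>m = M div 2\<close>, and carry the unspent budget of the
  counters, so that they add up over chunks, buckets and repetitions. Only inner points can pay,
  since they are checked after each outer chunk, whereas an outer point may meet a whole bucket
  before its check.\<close>

definition npairs :: "('a \<Rightarrow> 'b \<Rightarrow> bool) \<Rightarrow> 'a multiset \<Rightarrow> 'b multiset \<Rightarrow> nat" where
  "npairs P X Y = (\<Sum>x\<in>#X. size {#y \<in># Y. P x y#})"

lemma npairs_empty [simp]: "npairs P {#} Y = 0" "npairs P X {#} = 0"
  by (simp_all add: npairs_def)

lemma npairs_add_left: "npairs P (X + X') Y = npairs P X Y + npairs P X' Y"
  by (simp add: npairs_def)

lemma npairs_add_right: "npairs P X (Y + Y') = npairs P X Y + npairs P X Y'"
  by (simp add: npairs_def sum_mset.distrib)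

lemma npairs_mono:
  assumes "X \<subseteq># X'" "Y \<subseteq># Y'"
  shows "npairs P X Y \<le> npairs P X' Y'"
proof -
  obtain Z W where "X' = X + Z" "Y' = Y + W"
    using assms by (auto simp: subset_mset.le_iff_add)
  then show ?thesis
    by (simp add: npairs_add_left npairs_add_right)
qed

lemma npairs_cong:
  assumes "\<And>x y. x \<in># X \<Longrightarrow> y \<in># Y \<Longrightarrow> P x y = Q x y"
  shows "npairs P X Y = npairs Q X Y"
proof -
  have "{#y \<in># Y. P x y#} = {#y \<in># Y. Q x y#}" if "x \<in># X" for x
    using assms[OF that] by (auto intro: filter_mset_cong)
  then have "image_mset (\<lambda>x. size {#y \<in># Y. P x y#}) X = image_mset (\<lambda>x. size {#y \<in># Y. Q x y#}) X"
    by (intro image_mset_cong) auto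
  then show ?thesis
    by (simp add: npairs_def)
qed

lemma npairs_disj:
  assumes "\<And>x y. x \<in># X \<Longrightarrow> y \<in># Y \<Longrightarrow> \<not> (P x y \<and> Q x y)"
  shows "npairs (\<lambda>x y. P x y \<or> Q x y) X Y = npairs P X Y + npairs Q X Y"
proof -
  have "size {#y \<in># Y. P x y \<or> Q x y#} = size {#y \<in># Y. P x y#} + size {#y \<in># Y. Q x y#}"
    if "x \<in># X" for x
    using assms[OF that] by (induction Y) auto
  then have "image_mset (\<lambda>x. size {#y \<in># Y. P x y \<or> Q x y#}) X
      = image_mset (\<lambda>x. size {#y \<in># Y. P x y#} + size {#y \<in># Y. Q x y#}) X"
    by (intro image_mset_cong) auto
  then show ?thesis
    by (simp add: npairs_def sum_mset.distrib)
qed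

lemma npairs_total: "npairs P X Y + npairs (\<lambda>x y. \<not> P x y) X Y = size X * size Y"
proof -
  have "npairs (\<lambda>x y. P x y \<or> \<not> P x y) X Y = size X * size Y"
    by (induction X) (simp_all add: npairs_def)
  then show ?thesis
    by (subst (asm) npairs_disj) auto
qed

text \<open>The counters of inner points count a pair from the other side.\<close>

lemma npairs_swap: "npairs P X Y = npairs (\<lambda>y x. P x y) Y X"
proof (induction X)
  case (add x X)
  have "npairs P {#x#} Y = npairs (\<lambda>y x. P x y) Y {#x#}"
    by (induction Y) (simp_all add: npairs_def)
  then show ?case
    using add npairs_add_left[of P "{#x#}" X Y] npairs_add_right[of "\<lambda>y x. P x y" Y "{#x#}" X] by simp
qed simp

text \<open>Multisets make the counts additive over chunks and indifferent to sorting; only for the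
  distinct input lists do they become cardinalities of sets of pairs.\<close>

lemma npairs_mset_set:
  assumes "finite X" "finite Y"
  shows "npairs P (mset_set X) (mset_set Y) = card {(x, y). x \<in> X \<and> y \<in> Y \<and> P x y}"
proof -
  have "npairs P (mset_set X) (mset_set Y) = (\<Sum>x\<in>X. card {y \<in> Y. P x y})"
    using assms by (simp add: npairs_def sum_unfold_sum_mset filter_mset_mset_set)
  also have "\<dots> = card (SIGMA x:X. {y \<in> Y. P x y})"
    using assms by simp
  also have "(SIGMA x:X. {y \<in> Y. P x y}) = {(x, y). x \<in> X \<and> y \<in> Y \<and> P x y}"
    by auto
  finally show ?thesis .
qed

section \<open>Points without counters, counter updates and removals\<close>

definition points :: "'a item list \<Rightarrow> 'a multiset" where
  "points X = mset (map fst X)"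

lemma points_simps [simp]:
  "points [] = {#}" "points (x # X) = add_mset (fst x) (points X)" "points (X @ Y) = points X + points Y"
  by (simp_all add: points_def)

lemma set_points [simp]: "set_mset (points X) = fst ` set X"
  by (simp add: points_def)

lemma size_points [simp]: "size (points X) = length X"
  by (simp add: points_def)

lemma points_keep: "points (keep T X) \<subseteq># points X"
  by (induction X) (auto simp: keep_def intro: subset_mset.order_trans)

text \<open>An increment depends on the points of \<open>Y\<close> and not on their counters, so the
  order in which the counters of two loaded chunks are updated does not matter.\<close>

lemma bump_eq: "bump P X Y = map (\<lambda>(x, k). (x, k + size {#y \<in># points Y. P x y#})) X"
proof -
  have "length (filter (\<lambda>(y, _). P x y) Y) = size {#y \<in># points Y. P x y#}" for x
    by (induction Y) auto
  then show ?thesis by (simp add: bump_def)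
qed

lemma points_bump [simp]: "points (bump P X Y) = points X"
  by (induction X) (auto simp: bump_eq)

text \<open>Increments from successive inner chunks accumulate, so a pass acts on the outer chunk
  like one increment by the whole inner bucket.\<close>

lemma bump_bump: "bump P (bump P X Y) Z = bump P X (Y @ Z)"
  by (simp add: bump_eq split_def ac_simps)

lemma bump_Nil_right [simp]: "bump P X [] = X"
  by (simp add: bump_eq)

lemma bump_append: "bump P (X @ X') Y = bump P X Y @ bump P X' Y"
  by (simp add: bump_def)

lemma bump_cong_right: "points Y = points Y' \<Longrightarrow> bump P X Y = bump P X Y'"
  by (simp add: bump_eq)

lemma keep_append [simp]: "keep T (X @ Y) = keep T X @ keep T Y"
  by (simp add: keep_def)

lemma length_bump [simp]: "length (bump P X Y) = length X"
  by (simp add: bump_def)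

lemma length_keep: "length (keep T X) \<le> length X"
  by (simp add: keep_def)

text \<open>The amount by which the counters may still grow; it pays for the comparisons of far pairs.\<close>

definition budget :: "nat \<Rightarrow> 'a item list \<Rightarrow> nat" where
  "budget K X = (\<Sum>(x, k)\<leftarrow>X. K - k)"

lemma budget_append [simp]: "budget K (X @ Y) = budget K X + budget K Y"
  by (simp add: budget_def)

lemma budget_Nil [simp]: "budget K [] = 0"
  by (simp add: budget_def)

lemma budget_keep: "budget K (keep T X) \<le> budget K X"
  by (induction X) (auto simp: budget_def keep_def)

text \<open>The subtraction in \<open>budget\<close> is truncated. No entry can meet more than
  \<open>length Y\<close> others, so the hypothesis keeps all counters at or below \<open>K\<close>
  even after the increment; the subtraction is then exact, and the budget drops by one per counted
  pair.\<close>

lemma budget_bump: 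
  assumes "\<forall>(x, k) \<in> set X. k + length Y \<le> K"
  shows "budget K (bump P X Y) + npairs P (points X) (points Y) = budget K X"
  using assms
proof (induction X)
  case (Cons a X)
  have "size {#y \<in># points Y. P (fst a) y#} \<le> length Y"
    using size_filter_mset_lesseq[of _ "points Y"] by simp
  with Cons show ?case
    by (force simp: budget_def bump_eq npairs_def split_def)
qed (auto simp: budget_def bump_eq)

text \<open>For the outer chunk, whose counters may overshoot \<open>K\<close> during a pass:
  truncation loses the exact count but keeps the direction of the inequality.\<close>

lemma budget_bump_le: "budget K (bump P X Y) \<le> budget K X"
  by (induction X) (auto simp: budget_def bump_eq)

lemma budget_perm: "mset X = mset Y \<Longrightarrow> budget K X = budget K Y"
  unfolding budget_def sum_mset_sum_list[symmetric] mset_map by simp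

definition counters_le :: "nat \<Rightarrow> 'a item list \<Rightarrow> bool" where
  "counters_le T X \<longleftrightarrow> (\<forall>(x, k) \<in> set X. k \<le> T)"

lemma counters_le_append [simp]: "counters_le T (X @ Y) \<longleftrightarrow> counters_le T X \<and> counters_le T Y"
  by (auto simp: counters_le_def)

lemma counters_le_Nil [simp]: "counters_le T []"
  by (simp add: counters_le_def)

lemma counters_le_keep [simp]: "counters_le T (keep T X)"
  by (auto simp: counters_le_def keep_def)

text \<open>Stated without distinctness of the entries, so that it composes along the passes.\<close>

definition survives :: "nat \<Rightarrow> ('a \<Rightarrow> nat) \<Rightarrow> 'a item list \<Rightarrow> 'a item list \<Rightarrow> bool" where
  "survives T e X X' \<longleftrightarrow>
     (\<forall>(x, k) \<in> set X. k + e x \<le> T \<longrightarrow> (\<exists>k' \<le> k + e x. (x, k') \<in> set X'))"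

lemma survives_refl: "survives T e X X"
  unfolding survives_def using le_add1 by fast

text \<open>The new counter is at most the old one plus the allowance, so the allowances of
  successive steps add, and the threshold is tested against their total.\<close>

lemma survives_trans:
  assumes "survives T e X X'" "survives T e' X' X''"
  shows "survives T (\<lambda>x. e x + e' x) X X''"
  unfolding survives_def
proof (intro ballI, clarsimp)
  fix x k assume xk: "(x, k) \<in> set X" "k + (e x + e' x) \<le> T"
  with assms(1) obtain k' where "k' \<le> k + e x" "(x, k') \<in> set X'"
    unfolding survives_def by fastforce
  with assms(2) xk obtain k'' where "k'' \<le> k' + e' x" "(x, k'') \<in> set X''"
    unfolding survives_def by fastforce
  with \<open>k' \<le> k + e x\<close> show "\<exists>k''\<le>k + (e x + e' x). (x, k'') \<in> set X''"
    by (intro exI[of _ k'']) auto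
qed

lemma survives_append:
  assumes "survives T e X X'" "survives T e Y Y'"
  shows "survives T e (X @ Y) (X' @ Y')"
  using assms unfolding survives_def by fastforce

lemma survives_mono:
  assumes "survives T e X X'" "\<And>x. x \<in> fst ` set X \<Longrightarrow> e x \<le> e' x"
  shows "survives T e' X X'"
  unfolding survives_def
proof (intro ballI, clarsimp)
  fix x k assume xk: "(x, k) \<in> set X" "k + e' x \<le> T"
  then have "e x \<le> e' x" using assms(2) by force
  with xk assms(1) obtain k' where "k' \<le> k + e x" "(x, k') \<in> set X'"
    unfolding survives_def by fastforce
  with \<open>e x \<le> e' x\<close> show "\<exists>k'\<le>k + e' x. (x, k') \<in> set X'"
    by (intro exI[of _ k']) auto
qed

lemma survives_keep_bump:
  "survives T (\<lambda>x. size {#y \<in># points Y. P x y#}) X (keep T (bump P X Y))"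
  by (force simp: survives_def keep_def bump_eq)

section \<open>Block transfers\<close>

lemma blocks_eq:
  assumes "0 < B" "0 < n"
  shows "blocks B a n = {a div B..(a + n - 1) div B}"
proof
  show "blocks B a n \<subseteq> {a div B..(a + n - 1) div B}"
    using assms by (auto simp: blocks_def intro!: div_le_mono)
  show "{a div B..(a + n - 1) div B} \<subseteq> blocks B a n"
  proof
    fix j assume j: "j \<in> {a div B..(a + n - 1) div B}"
    then have "j * B \<le> (a + n - 1) div B * B" by simp
    also have "\<dots> \<le> a + n - 1" by simp
    finally have jB: "j * B \<le> a + n - 1" .
    \<comment> \<open>The first position of block \<open>j\<close> inside the segment.\<close>
    define i where "i = max a (j * B)"
    have "i div B = j"
    proof (cases "a \<le> j * B")
      case True
      then show ?thesis using assms by (simp add: i_def)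
    next
      case False
      then have "j \<le> a div B"
        using assms by (simp add: less_eq_div_iff_mult_less_eq)
      with False j show ?thesis by (simp add: i_def)
    qed
    moreover have "i \<in> {a..<a + n}"
      using jB assms by (auto simp: i_def)
    ultimately show "j \<in> blocks B a n"
      by (auto simp: blocks_def)
  qed
qed

lemma card_blocks_le:
  assumes "0 < B"
  shows "card (blocks B a n) \<le> n div B + 2"
proof (cases "n = 0")
  case False
  have "a + n - 1 < (a div B + n div B + 2) * B"
    using assms mod_less_divisor[of B a] mod_less_divisor[of B n] div_mult_mod_eq[of a B] div_mult_mod_eq[of n B]
    unfolding distrib_right by linarith
  then have "(a + n - 1) div B < a div B + n div B + 2"
    using assms by (simp add: div_less_iff_less_mult)
  then show ?thesis using False assms by (simp add: blocks_eq)
qed (simp add: blocks_def)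

text \<open>The cost of a sequence of transfers is bounded by means of the potential \<open>net\<close>: a transfer
  that moves the frame forwards costs at most the distance moved.\<close>

definition frame_pos :: "'a mach \<Rightarrow> arr \<Rightarrow> dir \<Rightarrow> nat" where
  "frame_pos s A D = (case frame s A D of None \<Rightarrow> 0 | Some j \<Rightarrow> Suc j)"

definition net :: "'a mach \<Rightarrow> int" where
  "net s = int (ios s) - int (frame_pos s Arr_R Read + 2 * frame_pos s Arr_R Write
     + frame_pos s Arr_S Read + 2 * frame_pos s Arr_S Write)"

text \<open>The price of rewinding a frame to position \<open>a\<close>. Moving back by \<delta>
  \<ge> 1 blocks gives up \<delta> units of the potential, and the block at \<open>a\<close>, no
  longer in the frame, is transferred again, which is one more unit and so at most \<delta>; hence
  the factor 2.\<close>

definition backlog :: "nat \<Rightarrow> 'a mach \<Rightarrow> arr \<Rightarrow> dir \<Rightarrow> nat \<Rightarrow> nat" where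
  "backlog B s A D a = 2 * dir_cost D * (frame_pos s A D - Suc (a div B))"

text \<open>This makes the backlog vanish at the start of the next bucket. The block of
  \<open>u A\<close> itself is allowed, as consecutive buckets may share it.\<close>

definition confined :: "nat \<Rightarrow> (arr \<Rightarrow> nat) \<Rightarrow> 'a mach \<Rightarrow> bool" where
  "confined B u s \<longleftrightarrow> (\<forall>A D. frame_pos s A D \<le> Suc (u A div B))"

lemma frame_pos_transfer:
  "frame_pos (transfer B A D a n s) A' D' =
     (if n \<noteq> 0 \<and> A' = A \<and> D' = D then Suc ((a + n - 1) div B) else frame_pos s A' D')"
  by (simp add: frame_pos_def transfer_def)

lemma backlog_transfer_other:
  "(A', D') \<noteq> (A, D) \<Longrightarrow> backlog B (transfer B A D a n s) A' D' x = backlog B s A' D' x"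
  by (auto simp: backlog_def frame_pos_transfer)

lemma emitted_transfer [simp]: "emitted (transfer B A D a n s) = emitted s"
  by (simp add: transfer_def)

lemma emitted_update_simps [simp]:
  "net (s\<lparr>emitted := E\<rparr>) = net s" "backlog B (s\<lparr>emitted := E\<rparr>) A D a = backlog B s A D a"
  "confined B u (s\<lparr>emitted := E\<rparr>) = confined B u s"
  by (simp_all add: net_def backlog_def confined_def frame_pos_def)

lemma confined_transfer:
  assumes "confined B u s" "a + n \<le> u A"
  shows "confined B u (transfer B A D a n s)"
proof -
  have "(a + n - 1) div B \<le> u A div B"
    using assms by (intro div_le_mono) simp
  with assms show ?thesis
    by (auto simp: confined_def frame_pos_transfer)
qed

lemma confined_backlog: "confined B u s \<Longrightarrow> u A \<le> a \<Longrightarrow> backlog B s A D a = 0"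
  unfolding confined_def backlog_def using div_le_mono[of "u A" a B]
  by (auto intro: order_trans)

lemma confined_mono: "confined B u s \<Longrightarrow> (\<And>A. u A \<le> u' A) \<Longrightarrow> confined B u' s"
  unfolding confined_def by (meson Suc_le_mono div_le_mono order_trans)

text \<open>The price of returning to the start \<open>b\<close> of a bucket of length
  \<open>n\<close> after a pass. Writing lags behind reading, so it may end at \<open>n'\<close>
  below \<open>n\<close>.\<close>

lemma backlog_shift:
  assumes "0 < B" "n' \<le> n"
  shows "backlog B s A D b \<le> backlog B s A D (b + n') + 2 * dir_cost D * (n div B + 1)"
proof -
  have "b + n' < (b div B + n div B + 2) * B"
    using assms mod_less_divisor[of B b] mod_less_divisor[of B n] div_mult_mod_eq[of b B] div_mult_mod_eq[of n B]
    unfolding distrib_right by linarith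
  then have "(b + n') div B < b div B + n div B + 2"
    using assms by (simp add: div_less_iff_less_mult)
  then have "frame_pos s A D - Suc (b div B) \<le> (frame_pos s A D - Suc ((b + n') div B)) + (n div B + 1)"
    by linarith
  then have "2 * dir_cost D * (frame_pos s A D - Suc (b div B))
      \<le> 2 * dir_cost D * ((frame_pos s A D - Suc ((b + n') div B)) + (n div B + 1))"
    by (rule mult_le_mono2)
  then show ?thesis by (simp add: backlog_def algebra_simps)
qed

text \<open>A transfer pays the backlog at its start and leaves none at its end; in between the rise
  of \<open>ios\<close> is matched by the advance of the frame.\<close>

lemma net_transfer:
  assumes "0 < B"
  shows "net (transfer B A D a n s) + int (backlog B (transfer B A D a n s) A D (a + n))
    \<le> net s + int (backlog B s A D a)"
proof (cases "n = 0")
  case True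
  then show ?thesis by (simp add: transfer_def)
next
  case False
  define st e where "st = a div B" and "e = (a + n - 1) div B"
  have "st \<le> e" using False by (auto simp: st_def e_def intro!: div_le_mono)
  have blk: "blocks B a n = {st..e}"
    using False assms by (simp add: blocks_eq st_def e_def)
  let ?k = "card (blocks B a n - set_option (frame s A D))"
  \<comment> \<open>If the frame is at or before block \<open>st\<close>, its advance to
    \<open>e\<close> covers all transferred blocks, because \<open>st\<close> is free when it is in
    the frame. Otherwise the backlog pays.\<close>
  have k: "?k + frame_pos s A D \<le> Suc e + 2 * (frame_pos s A D - Suc st)"
    using \<open>st \<le> e\<close> by (cases "frame s A D") (auto simp: blk frame_pos_def card_Diff_singleton_if)
  let ?t = "transfer B A D a n s"
  have "e \<le> (a + n) div B"
    unfolding e_def by (intro div_le_mono) simp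
  then have "backlog B ?t A D (a + n) = 0"
    using False by (simp add: backlog_def frame_pos_transfer e_def)
  moreover have "int (ios ?t) = int (ios s) + int (dir_cost D * ?k)"
    using False by (simp add: transfer_def)
  moreover have "int (dir_cost D * ?k) + int (dir_cost D * frame_pos s A D)
      \<le> int (dir_cost D * Suc e) + int (backlog B s A D a)"
    using mult_le_mono2[OF k, of "dir_cost D"] unfolding of_nat_add[symmetric] of_nat_le_iff
    by (simp add: backlog_def st_def algebra_simps)
  ultimately show ?thesis
    using False by (cases A; cases D) (simp_all add: net_def frame_pos_transfer e_def)
qed


section \<open>One outer chunk against a bucket, then all outer chunks\<close>

lemma other_neq [simp]: "other A \<noteq> A" "A \<noteq> other A"
  by (cases A; simp)+

lemma near_pairs_append_right:
  "near_pairs d r A X (Y @ Z) = near_pairs d r A X Y \<union> near_pairs d r A X Z"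
  unfolding near_pairs_def by (simp add: image_Un bex_Un) blast

lemma near_pairs_append_left:
  "near_pairs d r A (X @ Y) Z = near_pairs d r A X Z \<union> near_pairs d r A Y Z"
  unfolding near_pairs_def by (simp add: image_Un bex_Un) blast

text \<open>Both positions in the inner array only move forward during a pass, so the bound
  telescopes: the pass costs nothing in \<open>net\<close> beyond the backlog at its start. The
  return to the start of the bucket is left to the caller. With \<open>wr \<le> rd\<close> the
  writes stay within the segment that bounds the reads.\<close>

lemma inner_pass_spec:
  fixes d r c A
  defines "f \<equiv> \<lambda>x y. far d r c (orient A x y)"
  assumes B: "0 < B" 
  shows "\<exists>s'. inner_pass d r c B T A rd wr X Ys s =
      (bump f X (concat Ys), map (\<lambda>Y. keep T (bump (\<lambda>y x. f x y) Y X)) Ys, s') \<and>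
      emitted s' = emitted s \<union> near_pairs d r A X (concat Ys) \<and>
      net s' + int (backlog B s' (other A) Read (rd + length (concat Ys)))
        + int (backlog B s' (other A) Write
            (wr + length (keep T (bump (\<lambda>y x. f x y) (concat Ys) X))))
        \<le> net s + int (backlog B s (other A) Read rd) + int (backlog B s (other A) Write wr) \<and>
      (\<forall>D x. backlog B s' A D x = backlog B s A D x) \<and>
      (\<forall>u. confined B u s \<longrightarrow> wr \<le> rd \<longrightarrow> rd + length (concat Ys) \<le> u (other A) \<longrightarrow> confined B u s')"
proof (induction Ys arbitrary: rd wr X s)
  case Nil
  show ?case
    by (simp add: near_pairs_def keep_def bump_def)
next
  case (Cons Y Ys)
  define s1 where "s1 = transfer B (other A) Read rd (length Y) s"
  define s2 where "s2 = s1\<lparr>emitted := emitted s1 \<union> near_pairs d r A X Y\<rparr>"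
  define X' where "X' = bump f X Y"
  define Y' where "Y' = keep T (bump (\<lambda>y x. f x y) Y X)"
  define s3 where "s3 = transfer B (other A) Write wr (length Y') s2"
  have lenY': "length Y' \<le> length Y"
    unfolding Y'_def by (rule order_trans[OF length_keep]) simp
  have ptsX': "points X' = points X" by (simp add: X'_def)
  \<comment> \<open>The counters of the outer chunk change during the pass, its points do not; every
    inner chunk meets the same points.\<close>
  have b: "bump (\<lambda>y x. f x y) Z X' = bump (\<lambda>y x. f x y) Z X" for Z
    by (rule bump_cong_right[OF ptsX'])
  have "fst ` set X' = fst ` set X"
    using arg_cong[OF ptsX', of set_mset] by simp
  then have np: "near_pairs d r A X' Z = near_pairs d r A X Z" for Z
    by (simp add: near_pairs_def)
  obtain s' where s': "inner_pass d r c B T A (rd + length Y) (wr + length Y') X' Ys s3 =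
      (bump f X' (concat Ys), map (\<lambda>Y. keep T (bump (\<lambda>y x. f x y) Y X)) Ys, s')"
    and em: "emitted s' = emitted s3 \<union> near_pairs d r A X (concat Ys)"
    and cost: "net s' + int (backlog B s' (other A) Read (rd + length Y + length (concat Ys)))
        + int (backlog B s' (other A) Write
            (wr + length Y' + length (keep T (bump (\<lambda>y x. f x y) (concat Ys) X))))
        \<le> net s3 + int (backlog B s3 (other A) Read (rd + length Y))
          + int (backlog B s3 (other A) Write (wr + length Y'))"
    and bk: "\<forall>D x. backlog B s' A D x = backlog B s3 A D x"
    and wi: "\<forall>u. confined B u s3 \<longrightarrow> wr + length Y' \<le> rd + length Y \<longrightarrow>
        rd + length Y + length (concat Ys) \<le> u (other A) \<longrightarrow> confined B u s'"
    using Cons.IH[of "rd + length Y" "wr + length Y'" X' s3] unfolding b np by blast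
  have bks: "backlog B s3 A D x = backlog B s A D x" for D x
    by (simp add: s3_def s2_def s1_def backlog_transfer_other)
  have c1: "net s1 + int (backlog B s1 (other A) Read (rd + length Y)) \<le> net s + int (backlog B s (other A) Read rd)"
    unfolding s1_def by (rule net_transfer[OF B])
  have c3: "net s3 + int (backlog B s3 (other A) Write (wr + length Y')) \<le> net s2 + int (backlog B s2 (other A) Write wr)"
    unfolding s3_def by (rule net_transfer[OF B])
  have c4: "backlog B s3 (other A) Read (rd + length Y) = backlog B s1 (other A) Read (rd + length Y)"
    "backlog B s2 (other A) Write wr = backlog B s (other A) Write wr" "net s2 = net s1"
    by (simp_all add: s3_def s2_def s1_def backlog_transfer_other)
  have Xeq: "bump (\<lambda>x y. far d r c (orient A x y)) X Y = X'" "bump f X Y = X'"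
    by (simp_all add: X'_def f_def)
  have Yeq: "keep T (bump (\<lambda>y x. far d r c (orient A x y)) Y X) = Y'"
      "keep T (bump (\<lambda>y x. f x y) Y X) = Y'"
    by (simp_all add: Y'_def f_def)
  have "inner_pass d r c B T A rd wr X (Y # Ys) s =
      (bump f X (concat (Y # Ys)), map (\<lambda>Y. keep T (bump (\<lambda>y x. f x y) Y X)) (Y # Ys), s')"
    using s' Xeq Yeq
    by (simp add: Let_def s1_def[symmetric] s2_def[symmetric] s3_def[symmetric] bump_bump[symmetric])
  moreover have "emitted s' = emitted s \<union> near_pairs d r A X (concat (Y # Ys))"
    unfolding em by (auto simp: s3_def s2_def s1_def near_pairs_append_right)
  moreover have "net s' + int (backlog B s' (other A) Read (rd + length (concat (Y # Ys))))
        + int (backlog B s' (other A) Write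
            (wr + length (keep T (bump (\<lambda>y x. f x y) (concat (Y # Ys)) X))))
        \<le> net s + int (backlog B s (other A) Read rd) + int (backlog B s (other A) Write wr)"
    using cost c1 c3 c4 by (simp add: bump_append Y'_def[symmetric] add.assoc)
  moreover have "confined B u s'" if "confined B u s" "wr \<le> rd" "rd + length (concat (Y # Ys)) \<le> u (other A)" for u
  proof -
    have "confined B u s1" unfolding s1_def using that by (intro confined_transfer) auto
    then have "confined B u s3"
      unfolding s3_def s2_def using that lenY' by (intro confined_transfer) auto
    then show ?thesis using wi that lenY' by auto
  qed
  ultimately show ?case using bk bks by auto
qed

lemma near_pairs_mono:
  "fst ` set X \<subseteq> fst ` set X' \<Longrightarrow> fst ` set Y \<subseteq> fst ` set Y' \<Longrightarrow>
    near_pairs d r A X Y \<subseteq> near_pairs d r A X' Y'"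
  unfolding near_pairs_def by blast

lemma points_mono_set: "points X \<subseteq># points Y \<Longrightarrow> fst ` set X \<subseteq> fst ` set Y"
  using set_mset_mono by fastforce

text \<open>The allowance used in \<open>survives\<close>. It ignores counters and removals and is
  therefore monotone in the list.\<close>

definition far_count :: "('a \<Rightarrow> 'b \<Rightarrow> bool) \<Rightarrow> 'b item list \<Rightarrow> 'a \<Rightarrow> nat" where
  "far_count f Y x = size {#y \<in># points Y. f x y#}"

lemma far_count_mono: "points Y \<subseteq># points Y' \<Longrightarrow> far_count f Y x \<le> far_count f Y' x"
  unfolding far_count_def by (intro size_mset_mono multiset_filter_mono)

lemma far_count_append [simp]: "far_count f (X @ Y) x = far_count f X x + far_count f Y x"
  by (simp add: far_count_def)

text \<open>The effect of joining the lists \<open>X\<close> of array \<open>A\<close> and \<open>Y\<close> of the other array, where \<open>q x y\<close> says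
  that \<open>x\<close> and \<open>y\<close> are in the same bucket. In the bound on the transfers, \<open>g\<close> is the backlog at
  the start.\<close>

definition join_effect ::
  "('a \<Rightarrow> 'a \<Rightarrow> real) \<Rightarrow> real \<Rightarrow> real \<Rightarrow> nat \<Rightarrow> nat \<Rightarrow> nat \<Rightarrow> arr \<Rightarrow> ('a \<Rightarrow> 'a \<Rightarrow> bool) \<Rightarrow> nat
    \<Rightarrow> 'a item list \<Rightarrow> 'a item list \<Rightarrow> 'a mach \<Rightarrow> 'a item list \<Rightarrow> 'a item list \<Rightarrow> 'a mach \<Rightarrow> bool"
where
  "join_effect d r c m B T A q g X Y s X' Y' s' \<longleftrightarrow>
     points X' \<subseteq># points X \<and> points Y' \<subseteq># points Y \<and>
     counters_le T X' \<and> counters_le T Y' \<and>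
     survives T (far_count (\<lambda>x y. q x y \<and> far d r c (orient A x y)) Y) X X' \<and>
     survives T (far_count (\<lambda>y x. q x y \<and> far d r c (orient A x y)) X) Y Y' \<and>
     emitted s \<subseteq> emitted s' \<and> emitted s' \<subseteq> emitted s \<union> near_pairs d r A X Y \<and>
     (\<forall>x \<in> fst ` set X'. \<forall>y \<in> fst ` set Y'. q x y \<longrightarrow> near d r (orient A x y) \<longrightarrow>
        orient A x y \<in> emitted s') \<and>
     int (m * B) * net s' + int (6 * (budget (T + m) X' + budget (T + m) Y')) \<le>
     int (m * B) * (net s + int g) + int (6 * (budget (T + m) X + budget (T + m) Y +
        npairs (\<lambda>x y. q x y \<and> \<not> far d r c (orient A x y)) (points X) (points Y)
        + B * (length X + length Y)))"

lemma concat_map_keep_bump: "concat (map (\<lambda>Y. keep T (bump f Y X)) Ys) = keep T (bump f (concat Ys) X)"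
  by (induction Ys) (simp_all add: bump_append keep_def bump_def)

text \<open>Exactly the chunks that are followed by another one cause a rewind of the inner bucket;
  being full, they compare enough pairs to pay for it.\<close>

definition full_chunks :: "nat \<Rightarrow> 'b list list \<Rightarrow> bool" where
  "full_chunks m Xs \<longleftrightarrow> (\<forall>X \<in> set Xs. length X \<le> m) \<and> (\<forall>X \<in> set (butlast Xs). length X = m)"

text \<open>A pass is free in \<open>net\<close>; only the return to \<open>b\<close> before a
  further chunk costs, namely \<open>6 * (n div B + 1)\<close> for an inner bucket of length
  \<open>n\<close>. Multiplied by \<open>m * B\<close> this is at most
  \<open>6 * (m * n + m * B)\<close>. Here \<open>m * n\<close> is the number of pairs compared by a
  full chunk: the far ones are taken from the budget of the inner points, the others appear as
  \<open>npairs\<close>. The rest, \<open>m * B\<close>, is the chunk's share of the length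
  term.\<close>

lemma outer_pass_spec:
  fixes d r c A
  defines "f \<equiv> \<lambda>x y. far d r c (orient A x y)"
  assumes B: "0 < B" and full: "full_chunks m Xs"
    and le: "counters_le T (concat Ys)"
  shows "\<exists>Xs' Ys' s'. outer_pass d r c B T A rd wr b Xs Ys s = (Xs', Ys', s') \<and>
     join_effect d r c m B T A (\<lambda>_ _. True)
       (backlog B s A Read rd + backlog B s A Write wr
         + backlog B s (other A) Read b + backlog B s (other A) Write b)
       (concat Xs) (concat Ys) s (concat Xs') (concat Ys') s' \<and>
     (\<forall>u. confined B u s \<longrightarrow> wr \<le> rd \<longrightarrow> rd + length (concat Xs) \<le> u A
        \<longrightarrow> b + length (concat Ys) \<le> u (other A) \<longrightarrow> confined B u s')"
  using full le
proof (induction Xs arbitrary: rd wr Ys s)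
  case Nil
  then show ?case
    by (simp add: join_effect_def survives_refl far_count_def distrib_left)
next
  case (Cons X Xs)
  let ?Y = "concat Ys"
  define s1 where "s1 = transfer B A Read rd (length X) s"
  define X1 where "X1 = bump f X ?Y"
  define Ys1 where "Ys1 = map (\<lambda>Y. keep T (bump (\<lambda>y x. f x y) Y X)) Ys"
  define X' where "X' = keep T X1"
  define n where "n = length ?Y"
  have Y1: "concat Ys1 = keep T (bump (\<lambda>y x. f x y) ?Y X)"
    by (simp add: Ys1_def concat_map_keep_bump)
  obtain s2 where ip: "inner_pass d r c B T A b b X Ys s1 = (X1, Ys1, s2)"
    and em2: "emitted s2 = emitted s1 \<union> near_pairs d r A X ?Y"
    and cost2: "net s2 + int (backlog B s2 (other A) Read (b + n))
        + int (backlog B s2 (other A) Write (b + length (concat Ys1)))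
        \<le> net s1 + int (backlog B s1 (other A) Read b) + int (backlog B s1 (other A) Write b)"
    and bk2: "\<forall>D x. backlog B s2 A D x = backlog B s1 A D x"
    and conf2: "\<forall>u. confined B u s1 \<longrightarrow> b + n \<le> u (other A) \<longrightarrow> confined B u s2"
    using inner_pass_spec[OF B, of d r c T A b b X Ys s1]
    unfolding X1_def Ys1_def concat_map_keep_bump n_def f_def by blast
  define s3 where "s3 = transfer B A Write wr (length X') s2"
  have lenX': "length X' \<le> length X"
    unfolding X'_def X1_def by (rule order_trans[OF length_keep]) simp
  have lenY1: "length (concat Ys1) \<le> n"
    unfolding Y1 n_def by (rule order_trans[OF length_keep]) simp
  have c1: "net s1 + int (backlog B s1 A Read (rd + length X)) \<le> net s + int (backlog B s A Read rd)"
    unfolding s1_def by (rule net_transfer[OF B])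
  have c3: "net s3 + int (backlog B s3 A Write (wr + length X')) \<le> net s2 + int (backlog B s2 A Write wr)"
    unfolding s3_def by (rule net_transfer[OF B])
  have bks: "backlog B s1 A Write wr = backlog B s A Write wr"
    "backlog B s1 (other A) D x = backlog B s (other A) D x"
    "backlog B s3 A Read x = backlog B s2 A Read x"
    "backlog B s3 (other A) D x = backlog B s2 (other A) D x" for D x
    by (simp_all add: s1_def s3_def backlog_transfer_other)
  let ?g = "backlog B s A Read rd + backlog B s A Write wr
         + backlog B s (other A) Read b + backlog B s (other A) Write b"
  let ?g3 = "backlog B s3 A Read (rd + length X) + backlog B s3 A Write (wr + length X')
         + backlog B s3 (other A) Read b + backlog B s3 (other A) Write b"
  have cost: "net s3 + int (backlog B s3 A Read (rd + length X)) + int (backlog B s3 A Write (wr + length X'))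
      + int (backlog B s3 (other A) Read (b + n)) + int (backlog B s3 (other A) Write (b + length (concat Ys1)))
      \<le> net s + int ?g"
    using c1 c3 cost2 bk2 bks by simp
  \<comment> \<open>Weight 2 for the read frame and 4 for the write frame; together they are the
    factor 6 of \<open>join_effect\<close>.\<close>
  have "backlog B s3 (other A) Read b \<le> backlog B s3 (other A) Read (b + n) + 2 * (n div B + 1)"
    "backlog B s3 (other A) Write b \<le> backlog B s3 (other A) Write (b + length (concat Ys1)) + 4 * (n div B + 1)"
    using backlog_shift[OF B, of n n s3 "other A" Read b] backlog_shift[OF B lenY1, of s3 "other A" Write b]
    by simp_all
  with cost have cost': "net s3 + int ?g3 \<le> net s + int ?g + int (6 * (n div B + 1))"
    by simp
  from cost have cost0: "net s3 \<le> net s + int ?g" by simp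

  have fullXs: "full_chunks m Xs" and lenX: "length X \<le> m" and lenX_eq: "Xs \<noteq> [] \<Longrightarrow> length X = m"
    using Cons.prems(1) by (auto simp: full_chunks_def split: if_splits)
  have le1: "counters_le T (concat Ys1)" by (simp add: Y1)
  have budX: "budget (T + m) X' \<le> budget (T + m) X"
    unfolding X'_def X1_def by (meson budget_keep budget_bump_le order_trans)
  \<comment> \<open>An inner entry starts the pass with a counter of at most \<open>T\<close> and
    meets at most \<open>m\<close> outer points before its check; hence the capacity
    \<open>T + m\<close>.\<close>
  have "budget (T + m) (bump (\<lambda>y x. f x y) ?Y X) + npairs (\<lambda>y x. f x y) (points ?Y) (points X)
      = budget (T + m) ?Y"
    using Cons.prems(2) lenX by (intro budget_bump) (force simp: counters_le_def)
  moreover have "npairs (\<lambda>y x. f x y) (points ?Y) (points X) = npairs f (points X) (points ?Y)"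
    by (rule npairs_swap[symmetric])
  ultimately have budY: "budget (T + m) (concat Ys1) + npairs f (points X) (points ?Y) \<le> budget (T + m) ?Y"
    using budget_keep[of "T + m" T "bump (\<lambda>y x. f x y) ?Y X"] unfolding Y1 by linarith
  have tot: "npairs f (points X) (points ?Y) + npairs (\<lambda>x y. \<not> f x y) (points X) (points ?Y) = length X * n"
    using npairs_total[of f "points X" "points ?Y"] by (simp add: n_def)
  have ptsX': "points X' \<subseteq># points X"
    unfolding X'_def using points_keep[of T X1] by (simp add: X1_def)
  have ptsY1: "points (concat Ys1) \<subseteq># points ?Y"
    unfolding Y1 using points_keep[of T "bump (\<lambda>y x. f x y) ?Y X"] by simp
  have survX: "survives T (far_count f ?Y) X X'"
    unfolding X'_def X1_def far_count_def by (rule survives_keep_bump)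
  have survY: "survives T (far_count (\<lambda>y x. f x y) X) ?Y (concat Ys1)"
    unfolding Y1 far_count_def by (rule survives_keep_bump)
  have em3: "emitted s3 = emitted s \<union> near_pairs d r A X ?Y"
    by (simp add: s3_def em2 s1_def)

  obtain Xs' Ys' s' where op: "outer_pass d r c B T A (rd + length X) (wr + length X') b Xs Ys1 s3 = (Xs', Ys', s')"
    and eff: "join_effect d r c m B T A (\<lambda>_ _. True) ?g3 (concat Xs) (concat Ys1) s3 (concat Xs') (concat Ys') s'"
    and conf: "\<forall>u. confined B u s3 \<longrightarrow> wr + length X' \<le> rd + length X \<longrightarrow>
        rd + length X + length (concat Xs) \<le> u A
        \<longrightarrow> b + length (concat Ys1) \<le> u (other A) \<longrightarrow> confined B u s'"
    using Cons.IH[OF fullXs le1, of "rd + length X" "wr + length X'" s3] by blast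
  have eff: "points (concat Xs') \<subseteq># points (concat Xs)" "points (concat Ys') \<subseteq># points (concat Ys1)"
    "counters_le T (concat Xs')" "counters_le T (concat Ys')"
    "survives T (far_count f (concat Ys1)) (concat Xs) (concat Xs')"
    "survives T (far_count (\<lambda>y x. f x y) (concat Xs)) (concat Ys1) (concat Ys')"
    "emitted s3 \<subseteq> emitted s'" "emitted s' \<subseteq> emitted s3 \<union> near_pairs d r A (concat Xs) (concat Ys1)"
    "\<forall>x \<in> fst ` set (concat Xs'). \<forall>y \<in> fst ` set (concat Ys'). near d r (orient A x y) \<longrightarrow>
        orient A x y \<in> emitted s'"
    "int (m * B) * net s' + int (6 * (budget (T + m) (concat Xs') + budget (T + m) (concat Ys')))
      \<le> int (m * B) * (net s3 + int ?g3) + int (6 * (budget (T + m) (concat Xs) + budget (T + m) (concat Ys1) +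
          npairs (\<lambda>x y. \<not> f x y) (points (concat Xs)) (points (concat Ys1))
          + B * (length (concat Xs) + length (concat Ys1))))"
    using eff unfolding join_effect_def f_def by simp_all
  have run: "outer_pass d r c B T A rd wr b (X # Xs) Ys s = (X' # Xs', Ys', s')"
    using op ip by (simp add: Let_def s1_def[symmetric] s3_def[symmetric] X'_def[symmetric])
  have ptsY': "points (concat Ys') \<subseteq># points ?Y"
    using eff ptsY1 subset_mset.order_trans by blast
  have confined: "confined B u s'" if "confined B u s" "wr \<le> rd" "rd + length (concat (X # Xs)) \<le> u A"
      "b + length (concat Ys) \<le> u (other A)" for u
  proof -
    have "confined B u s1" unfolding s1_def using that by (intro confined_transfer) auto
    then have "confined B u s2" using conf2 that by (simp add: n_def)
    then have "confined B u s3"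
      unfolding s3_def using that lenX' by (intro confined_transfer) auto
    then show ?thesis using conf that lenX' lenY1 by (auto simp: n_def)
  qed
  have "points (concat (X' # Xs')) \<subseteq># points (concat (X # Xs))"
    using eff ptsX' by (simp add: subset_mset.add_mono)
  moreover have "counters_le T (concat (X' # Xs'))"
    using eff by (simp add: X'_def)
  moreover have "survives T (far_count f ?Y) (concat (X # Xs)) (concat (X' # Xs'))"
    unfolding concat.simps
  proof (rule survives_append[OF survX])
    \<comment> \<open>Later chunks meet only what the first pass has left; the allowance is enlarged
      to the inner bucket as it was at the start.\<close>
    have "survives T (far_count f (concat Ys1)) (concat Xs) (concat Xs')" using eff by simp
    then show "survives T (far_count f ?Y) (concat Xs) (concat Xs')"
      by (rule survives_mono) (rule far_count_mono[OF ptsY1])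
  qed
  moreover have "survives T (far_count (\<lambda>y x. f x y) (concat (X # Xs))) ?Y (concat Ys')"
  proof -
    have "survives T (far_count (\<lambda>y x. f x y) (concat Xs)) (concat Ys1) (concat Ys')" using eff by simp
    from survives_trans[OF survY this] show ?thesis by (rule survives_mono) simp
  qed
  moreover have "emitted s \<subseteq> emitted s'"
    using eff em3 by auto
  moreover have "emitted s' \<subseteq> emitted s \<union> near_pairs d r A (concat (X # Xs)) ?Y"
  proof -
    have "near_pairs d r A (concat Xs) (concat Ys1) \<subseteq> near_pairs d r A (concat Xs) ?Y"
      by (intro near_pairs_mono points_mono_set[OF ptsY1]) simp
    then show ?thesis using eff em3 by (auto simp: near_pairs_append_left)
  qed
  moreover have "orient A x y \<in> emitted s'"
    if "x \<in> fst ` set (concat (X' # Xs'))" "y \<in> fst ` set (concat Ys')" "near d r (orient A x y)" for x y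
  proof (cases "x \<in> fst ` set X'")
    case True
    \<comment> \<open>A surviving inner point was already present when \<open>X\<close> was
      processed, so the pair was emitted then.\<close>
    then have "orient A x y \<in> near_pairs d r A X ?Y"
      using that points_mono_set[OF ptsX'] points_mono_set[OF ptsY'] unfolding near_pairs_def by blast
    then show ?thesis using em3 eff by blast
  next
    case False
    then have "x \<in> fst ` set (concat Xs')" using that(1) by auto
    then show ?thesis using eff that by blast
  qed
  moreover have "int (m * B) * net s' + int (6 * (budget (T + m) (concat (X' # Xs')) + budget (T + m) (concat Ys')))
    \<le> int (m * B) * (net s + int ?g) + int (6 * (budget (T + m) (concat (X # Xs)) + budget (T + m) ?Y +
        npairs (\<lambda>x y. \<not> f x y) (points (concat (X # Xs))) (points ?Y)
        + B * (length (concat (X # Xs)) + length ?Y)))"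
  proof (cases "Xs = []")
    case True
    \<comment> \<open>No chunk follows, so nothing is rewound and \<open>cost0\<close> suffices,
      however short the chunk is.\<close>
    then have "Xs' = []" "Ys' = Ys1" "s' = s3" using op by auto
    moreover have "int (m * B) * net s3 \<le> int (m * B) * (net s + int ?g)"
      using cost0 by (rule mult_left_mono) simp
    moreover have "6 * (budget (T + m) X' + budget (T + m) (concat Ys1)) \<le>
        6 * (budget (T + m) X + budget (T + m) ?Y + npairs (\<lambda>x y. \<not> f x y) (points X) (points ?Y)
        + B * (length X + length ?Y))"
      using budX budY by (intro mult_le_mono2) linarith
    ultimately show ?thesis
      using True by (auto intro!: add_mono simp only: of_nat_le_iff concat.simps append_Nil2)
  next
    case False
    then have lX: "length X = m" by (rule lenX_eq)
    note IH = eff(10)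
    have "n div B * B \<le> n" by simp
    then have "m * B * (n div B + 1) \<le> m * n + m * B"
      by (simp add: algebra_simps)
    then have "6 * (m * B * (n div B + 1)) \<le> 6 * (m * n + m * B)"
      by (rule mult_le_mono2)
    then have "int (m * B) * int (6 * (n div B + 1)) \<le> int (6 * (m * n + m * B))"
      unfolding of_nat_mult[symmetric] of_nat_le_iff by (simp only: mult.left_commute)
    moreover have "int (m * B) * (net s3 + int ?g3) \<le> int (m * B) * (net s + int ?g + int (6 * (n div B + 1)))"
      using cost' by (rule mult_left_mono) simp
    ultimately have c: "int (m * B) * (net s3 + int ?g3) \<le> int (m * B) * (net s + int ?g) + int (6 * (m * n + m * B))"
      by (simp only: distrib_left)
    have "npairs (\<lambda>x y. \<not> f x y) (points (concat Xs)) (points (concat Ys1))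
        \<le> npairs (\<lambda>x y. \<not> f x y) (points (concat Xs)) (points ?Y)"
      by (rule npairs_mono[OF subset_mset.order_refl ptsY1])
    moreover have "B * length (concat Ys1) \<le> B * n" using lenY1 by (rule mult_le_mono2)
    ultimately have r: "6 * (m * n + m * B) + 6 * (budget (T + m) (concat Xs) + budget (T + m) (concat Ys1) +
          npairs (\<lambda>x y. \<not> f x y) (points (concat Xs)) (points (concat Ys1))
          + B * (length (concat Xs) + length (concat Ys1))) + 6 * budget (T + m) X'
        \<le> 6 * (budget (T + m) (concat (X # Xs)) + budget (T + m) ?Y +
          npairs (\<lambda>x y. \<not> f x y) (points (concat (X # Xs))) (points ?Y)
          + B * (length (concat (X # Xs)) + length ?Y))"
      using budX budY tot lX
      unfolding concat.simps points_simps budget_append length_append npairs_add_left distrib_left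
        n_def[symmetric] lX mult.commute[of B m] by linarith
    have combine: "x + int p' \<le> z + int q'"
      if "x + int p \<le> y + int q" "y \<le> z + int k" "k + q + l \<le> q'" "p' = l + p"
      for x y z :: int and p p' q q' k l :: nat
      using that by linarith
    show ?thesis
      by (rule combine[OF IH c r]) simp
  qed
  ultimately have "join_effect d r c m B T A (\<lambda>_ _. True) ?g (concat (X # Xs)) ?Y s (concat (X' # Xs')) (concat Ys') s'"
    using ptsY' eff(4) unfolding join_effect_def f_def simp_thms
    by - (intro conjI ballI impI; (assumption | blast))
  then show ?case
    unfolding run using confined by blast
qed

section \<open>Buckets and sorting\<close>

lemma concat_chunks: "concat (chunks k xs) = xs"
proof (induction k xs rule: chunks.induct)
  case (1 k xs)
  then show ?case by (subst chunks.simps) auto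
qed

lemma chunks_Nil: "chunks k [] = []"
  by (subst chunks.simps) simp

lemma chunks_step: "0 < k \<Longrightarrow> xs \<noteq> [] \<Longrightarrow> chunks k xs = take k xs # chunks k (drop k xs)"
  by (subst chunks.simps) simp

lemma full_chunks_Cons:
  assumes "full_chunks m Xs" "length X \<le> m" "Xs = [] \<or> length X = m"
  shows "full_chunks m (X # Xs)"
  using assms by (cases Xs) (simp_all add: full_chunks_def)

lemma full_chunks_chunks:
  assumes "0 < k"
  shows "full_chunks k (chunks k xs)"
proof (induction "length xs" arbitrary: xs rule: less_induct)
  case less
  show ?case
  proof (cases "xs = []")
    case True
    then show ?thesis by (simp add: chunks_Nil full_chunks_def)
  next
    case False
    have "chunks k (drop k xs) = [] \<or> length (take k xs) = k"
      by (cases "length xs \<le> k") (simp_all add: chunks_Nil)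
    moreover have "full_chunks k (chunks k (drop k xs))"
      using assms False by (intro less) simp
    ultimately show ?thesis
      unfolding chunks_step[OF assms False] by (intro full_chunks_Cons) auto
  qed
qed

section \<open>From one bucket to all buckets\<close>

lemma join_effectD:
  assumes "join_effect d r c m B T A q g X Y s X' Y' s'"
  shows "points X' \<subseteq># points X" "points Y' \<subseteq># points Y"
    "counters_le T X'" "counters_le T Y'"
    "survives T (far_count (\<lambda>x y. q x y \<and> far d r c (orient A x y)) Y) X X'"
    "survives T (far_count (\<lambda>y x. q x y \<and> far d r c (orient A x y)) X) Y Y'"
    "emitted s \<subseteq> emitted s'" "emitted s' \<subseteq> emitted s \<union> near_pairs d r A X Y"
    "\<And>x y. x \<in> fst ` set X' \<Longrightarrow> y \<in> fst ` set Y' \<Longrightarrow> q x y \<Longrightarrow> near d r (orient A x y) \<Longrightarrow>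
        orient A x y \<in> emitted s'"
    "int (m * B) * net s' + int (6 * (budget (T + m) X' + budget (T + m) Y')) \<le>
     int (m * B) * (net s + int g) + int (6 * (budget (T + m) X + budget (T + m) Y +
        npairs (\<lambda>x y. q x y \<and> \<not> far d r c (orient A x y)) (points X) (points Y)
        + B * (length X + length Y)))"
  using assms unfolding join_effect_def by - (elim conjE, assumption | elim conjE, blast)+

lemma join_effect_swap:
  assumes "join_effect d r c m B T Arr_S (\<lambda>_ _. True) g Y X s Y' X' s'"
  shows "join_effect d r c m B T Arr_R (\<lambda>_ _. True) g X Y s X' Y' s'"
proof -
  have "near_pairs d r Arr_S Y X = near_pairs d r Arr_R X Y"
    unfolding near_pairs_def orient_def by auto
  moreover have "npairs (\<lambda>y x. \<not> far d r c (x, y)) (points Y) (points X)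
      = npairs (\<lambda>x y. \<not> far d r c (x, y)) (points X) (points Y)"
    by (rule npairs_swap)
  ultimately show ?thesis
    using assms unfolding join_effect_def by (simp add: orient_def add_ac)
qed

text \<open>The effect does not see the order of the entries. This transports it through sorting and
  through the regrouping into buckets; inside a bucket it turns the trivial condition into equality
  of hash values.\<close>

lemma join_effect_cong:
  assumes eff: "join_effect d r c m B T A q g X Y s X' Y' s'"
    and X: "mset X = mset V" and Y: "mset Y = mset W"
    and q: "\<And>x y. x \<in> fst ` set X \<Longrightarrow> y \<in> fst ` set Y \<Longrightarrow> q x y = q' x y"
  shows "join_effect d r c m B T A q' g V W s X' Y' s'"
proof -
  let ?f = "\<lambda>x y. far d r c (orient A x y)"
  have set: "set X = set V" "set Y = set W"
    using mset_eq_setD[OF X] mset_eq_setD[OF Y] by simp_all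
  have pts: "points X = points V" "points Y = points W"
    using X Y by (simp_all add: points_def)
  have len: "length X = length V" "length Y = length W"
    using mset_eq_length[OF X] mset_eq_length[OF Y] by simp_all
  have bud: "budget K X = budget K V" "budget K Y = budget K W" for K
    by (rule budget_perm[OF X], rule budget_perm[OF Y])
  have np: "near_pairs d r A X Y = near_pairs d r A V W"
    by (simp add: near_pairs_def set)
  have pairs: "npairs (\<lambda>x y. q x y \<and> \<not> ?f x y) (points V) (points W) =
      npairs (\<lambda>x y. q' x y \<and> \<not> ?f x y) (points V) (points W)"
    by (rule npairs_cong) (use q set in auto)
  note eff = eff[unfolded join_effect_def pts len bud np pairs]
  have fcX: "far_count (\<lambda>x y. q x y \<and> ?f x y) Y x = far_count (\<lambda>x y. q' x y \<and> ?f x y) W x"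
    if "x \<in> fst ` set X" for x
    unfolding far_count_def pts
    by (rule arg_cong[of _ _ size], rule filter_mset_cong) (use q that set in auto)
  have fcY: "far_count (\<lambda>y x. q x y \<and> ?f x y) X y = far_count (\<lambda>y x. q' x y \<and> ?f x y) V y"
    if "y \<in> fst ` set Y" for y
    unfolding far_count_def pts
    by (rule arg_cong[of _ _ size], rule filter_mset_cong) (use q that set in auto)
  have "survives T (far_count (\<lambda>x y. q x y \<and> ?f x y) Y) X X'"
    using eff by blast
  then have "survives T (far_count (\<lambda>x y. q' x y \<and> ?f x y) W) X X'"
    by (rule survives_mono) (simp add: fcX)
  then have sX: "survives T (far_count (\<lambda>x y. q' x y \<and> ?f x y) W) V X'"
    unfolding survives_def set .
  have "survives T (far_count (\<lambda>y x. q x y \<and> ?f x y) X) Y Y'"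
    using eff by blast
  then have "survives T (far_count (\<lambda>y x. q' x y \<and> ?f x y) V) Y Y'"
    by (rule survives_mono) (simp add: fcY)
  then have sY: "survives T (far_count (\<lambda>y x. q' x y \<and> ?f x y) V) W Y'"
    unfolding survives_def set .
  have "\<forall>x \<in> fst ` set X'. \<forall>y \<in> fst ` set Y'. q' x y \<longrightarrow> near d r (orient A x y) \<longrightarrow>
        orient A x y \<in> emitted s'"
  proof (intro ballI impI)
    fix x y assume xy: "x \<in> fst ` set X'" "y \<in> fst ` set Y'" "q' x y" "near d r (orient A x y)"
    have "points X' \<subseteq># points V" "points Y' \<subseteq># points W" using eff by blast+
    from this[THEN points_mono_set] have "x \<in> fst ` set X" "y \<in> fst ` set Y"
      using xy unfolding set by blast+
    then have "q x y" using q xy by blast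
    then show "orient A x y \<in> emitted s'" using eff xy by blast
  qed
  then show ?thesis
    using eff sX sY unfolding join_effect_def by blast
qed

text \<open>Completeness uses \<open>cross\<close>: two points with \<open>q x y\<close> lie in the
  same part. In the cost, pairs across the parts only enlarge the right side. Both backlogs are 0,
  which \<open>confined\<close> provides for consecutive buckets.\<close>

lemma join_effect_append:
  assumes e1: "join_effect d r c m B T A q 0 X1 Y1 s X1' Y1' s1"
    and e2: "join_effect d r c m B T A q 0 X2 Y2 s1 X2' Y2' s2"
    and cross: "\<And>x y. x \<in> fst ` set X1 \<Longrightarrow> y \<in> fst ` set Y2 \<Longrightarrow> \<not> q x y"
      "\<And>x y. x \<in> fst ` set X2 \<Longrightarrow> y \<in> fst ` set Y1 \<Longrightarrow> \<not> q x y"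
  shows "join_effect d r c m B T A q 0 (X1 @ X2) (Y1 @ Y2) s (X1' @ X2') (Y1' @ Y2') s2"
proof -
  let ?f = "\<lambda>x y. far d r c (orient A x y)"
  note e1 = join_effectD[OF e1] and e2 = join_effectD[OF e2]
  have pts: "points X1' \<subseteq># points X1" "points Y1' \<subseteq># points Y1"
     "points X2' \<subseteq># points X2" "points Y2' \<subseteq># points Y2"
    by (rule e1 e2)+
  note sub = pts[THEN points_mono_set]
  have pts': "points (X1' @ X2') \<subseteq># points (X1 @ X2)" "points (Y1' @ Y2') \<subseteq># points (Y1 @ Y2)"
    unfolding points_simps by (rule subset_mset.add_mono pts)+
  have surv: "survives T (far_count f (V @ W)) (X @ Z) (X' @ Z')"
    if "survives T (far_count f V) X X'" "survives T (far_count f W) Z Z'"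
    for X Z X' Z' V W :: "'a item list" and f
  proof (rule survives_append)
    show "survives T (far_count f (V @ W)) X X'"
      by (rule survives_mono[OF that(1)]) simp
    show "survives T (far_count f (V @ W)) Z Z'"
      by (rule survives_mono[OF that(2)]) simp
  qed
  have sX: "survives T (far_count (\<lambda>x y. q x y \<and> ?f x y) (Y1 @ Y2)) (X1 @ X2) (X1' @ X2')"
    by (rule surv[OF e1(5) e2(5)])
  have sY: "survives T (far_count (\<lambda>y x. q x y \<and> ?f x y) (X1 @ X2)) (Y1 @ Y2) (Y1' @ Y2')"
    by (rule surv[OF e1(6) e2(6)])
  have cnt: "counters_le T (X1' @ X2')" "counters_le T (Y1' @ Y2')"
    unfolding counters_le_append by (intro conjI e1 e2)+
  have em: "emitted s \<subseteq> emitted s1" "emitted s1 \<subseteq> emitted s2"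
      "emitted s1 \<subseteq> emitted s \<union> near_pairs d r A X1 Y1" "emitted s2 \<subseteq> emitted s1 \<union> near_pairs d r A X2 Y2"
    by (rule e1 e2)+
  then have em': "emitted s \<subseteq> emitted s2" "emitted s2 \<subseteq> emitted s \<union> near_pairs d r A (X1 @ X2) (Y1 @ Y2)"
    unfolding near_pairs_append_left near_pairs_append_right by blast+
  have compl: "\<forall>x \<in> fst ` set (X1' @ X2'). \<forall>y \<in> fst ` set (Y1' @ Y2'). q x y \<longrightarrow> near d r (orient A x y) \<longrightarrow>
        orient A x y \<in> emitted s2"
  proof (intro ballI impI)
    fix x y assume xy: "x \<in> fst ` set (X1' @ X2')" "y \<in> fst ` set (Y1' @ Y2')" "q x y" "near d r (orient A x y)"
    have "x \<in> fst ` set X1' \<or> x \<in> fst ` set X2'" "y \<in> fst ` set Y1' \<or> y \<in> fst ` set Y2'"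
      using xy(1,2) unfolding set_append image_Un by blast+
    moreover have "\<not> (x \<in> fst ` set X1' \<and> y \<in> fst ` set Y2')" "\<not> (x \<in> fst ` set X2' \<and> y \<in> fst ` set Y1')"
      using cross(1)[of x y] cross(2)[of x y] sub[THEN subsetD] xy(3) by metis+
    ultimately consider "x \<in> fst ` set X1'" "y \<in> fst ` set Y1'" | "x \<in> fst ` set X2'" "y \<in> fst ` set Y2'"
      by blast
    then show "orient A x y \<in> emitted s2"
    proof cases
      case 1
      then have "orient A x y \<in> emitted s1" using e1(9) xy(3,4) by blast
      then show ?thesis using em by blast
    next
      case 2
      then show ?thesis using e2(9) xy(3,4) by blast
    qed
  qed
  have cost1: "int (m * B) * net s1 + int (6 * (budget (T + m) X1' + budget (T + m) Y1')) \<le>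
     int (m * B) * (net s + int 0) + int (6 * (budget (T + m) X1 + budget (T + m) Y1 +
        npairs (\<lambda>x y. q x y \<and> \<not> ?f x y) (points X1) (points Y1) + B * (length X1 + length Y1)))"
    by (rule e1(10))
  have cost2: "int (m * B) * net s2 + int (6 * (budget (T + m) X2' + budget (T + m) Y2')) \<le>
     int (m * B) * (net s1 + int 0) + int (6 * (budget (T + m) X2 + budget (T + m) Y2 +
        npairs (\<lambda>x y. q x y \<and> \<not> ?f x y) (points X2) (points Y2) + B * (length X2 + length Y2)))"
    by (rule e2(10))
  have "int (m * B) * net s2 + int (6 * (budget (T + m) (X1' @ X2') + budget (T + m) (Y1' @ Y2'))) \<le>
     int (m * B) * (net s + int 0) + int (6 * (budget (T + m) (X1 @ X2) + budget (T + m) (Y1 @ Y2) +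
        npairs (\<lambda>x y. q x y \<and> \<not> ?f x y) (points (X1 @ X2)) (points (Y1 @ Y2))
        + B * (length (X1 @ X2) + length (Y1 @ Y2))))"
    using cost1 cost2 unfolding points_simps budget_append length_append npairs_add_left npairs_add_right
    by (simp add: distrib_left)
  then show ?thesis
    unfolding join_effect_def using pts' cnt sX sY em' compl by (intro conjI)
qed

text \<open>Buckets occupy consecutive segments. No frame is past the start of the bucket when it
  begins, so there is no backlog, and none passes its end. Hence no bucket pays for a block of its
  own.\<close>

lemma join_bucket_spec:
  assumes B: "0 < B" and M: "2 \<le> M"
    and le: "counters_le T Rv" "counters_le T Sv"
    and conf: "confined B (case_arr a b) s"
  shows "\<exists>R' S' s'. join_bucket d r c M B T a b Rv Sv s = (R', S', s') \<and>
     join_effect d r c (M div 2) B T Arr_R (\<lambda>_ _. True) 0 Rv Sv s R' S' s' \<and>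
     confined B (case_arr (a + length Rv) (b + length Sv)) s'"
proof -
  have m: "0 < M div 2" using M by simp
  have conf': "confined B (case_arr (a + length Rv) (b + length Sv)) s"
    by (rule confined_mono[OF conf]) (simp split: arr.split)
  have z: "backlog B s Arr_R D a = 0" "backlog B s Arr_S D b = 0" for D
    using confined_backlog[OF conf] by simp_all
  show ?thesis
  proof (cases "length Rv \<le> length Sv")
    case True
    obtain Xs Ys s' where op: "outer_pass d r c B T Arr_R a a b (chunks (M div 2) Rv) (chunks (M div 2) Sv) s = (Xs, Ys, s')"
      and eff: "join_effect d r c (M div 2) B T Arr_R (\<lambda>_ _. True) 0 Rv Sv s (concat Xs) (concat Ys) s'"
      and u: "\<forall>u. confined B u s \<longrightarrow> a + length Rv \<le> u Arr_R
        \<longrightarrow> b + length Sv \<le> u Arr_S \<longrightarrow> confined B u s'"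
      using outer_pass_spec[OF B full_chunks_chunks[OF m], of T "chunks (M div 2) Sv" d r c Arr_R a a b Rv s]
      unfolding concat_chunks z other.simps le_refl simp_thms add_0_left using le(2) by blast
    have "confined B (case_arr (a + length Rv) (b + length Sv)) s'"
      using u conf' by simp
    moreover have "join_bucket d r c M B T a b Rv Sv s = (concat Xs, concat Ys, s')"
      using True op by (simp add: join_bucket_def)
    ultimately show ?thesis using eff by blast
  next
    case False
    obtain Xs Ys s' where op: "outer_pass d r c B T Arr_S b b a (chunks (M div 2) Sv) (chunks (M div 2) Rv) s = (Xs, Ys, s')"
      and eff: "join_effect d r c (M div 2) B T Arr_S (\<lambda>_ _. True) 0 Sv Rv s (concat Xs) (concat Ys) s'"
      and u: "\<forall>u. confined B u s \<longrightarrow> b + length Sv \<le> u Arr_S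
        \<longrightarrow> a + length Rv \<le> u Arr_R \<longrightarrow> confined B u s'"
      using outer_pass_spec[OF B full_chunks_chunks[OF m], of T "chunks (M div 2) Rv" d r c Arr_S b b a Sv s]
      unfolding concat_chunks z other.simps le_refl simp_thms add_0_left using le(1) by blast
    have "confined B (case_arr (a + length Rv) (b + length Sv)) s'"
      using u conf' by simp
    moreover have "join_bucket d r c M B T a b Rv Sv s = (concat Ys, concat Xs, s')"
      using False op by (simp add: join_bucket_def)
    ultimately show ?thesis using join_effect_swap[OF eff] by blast
  qed
qed

lemma mset_filter_insert:
  assumes "v \<notin> V"
  shows "mset (filter (\<lambda>x. f x = v) xs @ filter (\<lambda>x. f x \<in> V) xs) = mset (filter (\<lambda>x. f x \<in> insert v V) xs)"
  using assms by (induction xs) auto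

lemma join_buckets_spec:
  assumes B: "0 < B" and M: "2 \<le> M"
    and le: "counters_le T Rs" "counters_le T Ss"
    and "distinct vs" and "confined B (case_arr a b) s"
  shows "\<exists>R' S' s'. join_buckets d r c M B T h Rs Ss vs a b s = (R', S', s') \<and>
     join_effect d r c (M div 2) B T Arr_R (\<lambda>x y. h x = h y) 0
       (filter (\<lambda>x. h (fst x) \<in> set vs) Rs) (filter (\<lambda>x. h (fst x) \<in> set vs) Ss) s R' S' s' \<and>
     confined B (case_arr (a + length (filter (\<lambda>x. h (fst x) \<in> set vs) Rs))
        (b + length (filter (\<lambda>x. h (fst x) \<in> set vs) Ss))) s'"
  using assms(5,6)
proof (induction vs arbitrary: a b s)
  case Nil
  then show ?case
    by (auto simp: join_effect_def survives_def far_count_def near_pairs_def)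
next
  case (Cons v vs)
  let ?R = "\<lambda>V. filter (\<lambda>x. h (fst x) \<in> V) Rs" and ?S = "\<lambda>V. filter (\<lambda>x. h (fst x) \<in> V) Ss"
  let ?Rv = "filter (\<lambda>x. h (fst x) = v) Rs" and ?Sv = "filter (\<lambda>x. h (fst x) = v) Ss"
  have "counters_le T ?Rv" "counters_le T ?Sv"
    using le by (auto simp: counters_le_def)
  from join_bucket_spec[OF B M this Cons.prems(2), of d r c]
  obtain R1 S1 s1 where jb: "join_bucket d r c M B T a b ?Rv ?Sv s = (R1, S1, s1)"
    and e1: "join_effect d r c (M div 2) B T Arr_R (\<lambda>_ _. True) 0 ?Rv ?Sv s R1 S1 s1"
    and c1: "confined B (case_arr (a + length ?Rv) (b + length ?Sv)) s1"
    by blast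
  have "distinct vs" "v \<notin> set vs" using Cons.prems by auto
  from Cons.IH[OF this(1) c1] obtain R2 S2 s2
    where jbs: "join_buckets d r c M B T h Rs Ss vs (a + length ?Rv) (b + length ?Sv) s1 = (R2, S2, s2)"
    and e2: "join_effect d r c (M div 2) B T Arr_R (\<lambda>x y. h x = h y) 0 (?R (set vs)) (?S (set vs)) s1 R2 S2 s2"
    and c2: "confined B (case_arr (a + length ?Rv + length (?R (set vs))) (b + length ?Sv + length (?S (set vs)))) s2"
    by blast
  note ms = mset_filter_insert[OF \<open>v \<notin> set vs\<close>, of "\<lambda>x. h (fst x)"]
  have e1': "join_effect d r c (M div 2) B T Arr_R (\<lambda>x y. h x = h y) 0 ?Rv ?Sv s R1 S1 s1"
    by (rule join_effect_cong[OF e1]) auto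
  have "join_effect d r c (M div 2) B T Arr_R (\<lambda>x y. h x = h y) 0 (?Rv @ ?R (set vs)) (?Sv @ ?S (set vs)) s
      (R1 @ R2) (S1 @ S2) s2"
    by (rule join_effect_append[OF e1' e2]) (use \<open>v \<notin> set vs\<close> in auto)
  then have "join_effect d r c (M div 2) B T Arr_R (\<lambda>x y. h x = h y) 0
      (?R (insert v (set vs))) (?S (insert v (set vs))) s (R1 @ R2) (S1 @ S2) s2"
    by (rule join_effect_cong) (rule ms refl)+
  moreover have "length (?R (insert v (set vs))) = length ?Rv + length (?R (set vs))"
    "length (?S (insert v (set vs))) = length ?Sv + length (?S (set vs))"
    using mset_eq_length[OF ms[of Rs]] mset_eq_length[OF ms[of Ss]] by simp_all
  ultimately show ?case
    using jb jbs c2 by (simp add: Let_def add.assoc)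
qed

section \<open>External merge sort\<close>

lemma mset_merge_key [simp]: "mset (merge_key f xs ys) = mset xs + mset ys"
  by (induction f xs ys rule: merge_key.induct) auto

lemma scan_cost_le: "0 < B \<Longrightarrow> scan_cost B D a n \<le> dir_cost D * (n div B + 2)"
  unfolding scan_cost_def by (intro mult_le_mono2 card_blocks_le)

lemma mult_scan_cost_le: "0 < B \<Longrightarrow> B * scan_cost B D a n \<le> dir_cost D * (n + 2 * B)"
proof -
  assume "0 < B"
  then have "B * scan_cost B D a n \<le> B * (dir_cost D * (n div B + 2))"
    by (intro mult_le_mono2 scan_cost_le)
  also have "\<dots> = dir_cost D * (B * (n div B) + 2 * B)"
    by (simp add: algebra_simps)
  also have "\<dots> \<le> dir_cost D * (n + 2 * B)"
    by (intro mult_le_mono2 add_right_mono) simp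
  finally show ?thesis .
qed

lemma ext_sort_base:
  "length xs \<le> max 1 M \<Longrightarrow> ext_sort M B f a xs =
    (sort_key f xs, scan_cost B Read a (length xs) + scan_cost B Write a (length xs))"
  by (subst ext_sort.simps) simp

lemma ext_sort_step:
  assumes "\<not> length xs \<le> max 1 M"
  defines "l \<equiv> length xs div 2"
  shows "ext_sort M B f a xs =
    (merge_key f (fst (ext_sort M B f a (take l xs))) (fst (ext_sort M B f (a + l) (drop l xs))),
     snd (ext_sort M B f a (take l xs)) + snd (ext_sort M B f (a + l) (drop l xs))
        + scan_cost B Read a l + scan_cost B Read (a + l) (length xs - l) + scan_cost B Write a (length xs))"
  using assms(1) by (subst ext_sort.simps) (simp add: Let_def split_def l_def)

lemma mset_ext_sort: "mset (fst (ext_sort M B f a xs)) = mset xs"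
proof (induction "length xs" arbitrary: a xs rule: less_induct)
  case less
  show ?case
  proof (cases "length xs \<le> max 1 M")
    case True
    then show ?thesis by (simp add: ext_sort_base)
  next
    case False
    let ?l = "length xs div 2"
    have "mset (fst (ext_sort M B f a (take ?l xs))) = mset (take ?l xs)"
      "mset (fst (ext_sort M B f (a + ?l) (drop ?l xs))) = mset (drop ?l xs)"
      using False by (auto intro!: less)
    moreover have "mset (take ?l xs) + mset (drop ?l xs) = mset xs"
      by (metis append_take_drop_id mset_append)
    ultimately show ?thesis
      by (simp add: ext_sort_step[OF False])
  qed
qed

text \<open>\<open>D\<close> bounds the depth of the recursion. Rounding to blocks adds a few
  \<open>B\<close> per scan, which the length absorbs: a run costs \<open>3 * n + 6 * B\<close> with
  \<open>B \<le> n\<close>, a merge \<open>3 * n + 8 * B\<close> with \<open>2 * B \<le> n\<close>,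
  both at most \<open>9 * n\<close>. The lower bound on the length passes to the halves, since only
  lists longer than \<open>M \<ge> 2 * B\<close> are split.\<close>

lemma ext_sort_cost:
  assumes "0 < B" "2 * B \<le> M" "B \<le> length xs" "length xs \<le> 2 ^ D"
  shows "B * snd (ext_sort M B f a xs) \<le> 9 * length xs * (D + 1)"
  using assms(3,4)
proof (induction D arbitrary: a xs)
  case 0
  then have "length xs \<le> max 1 M" by simp
  then have "ext_sort M B f a xs = (sort_key f xs, scan_cost B Read a (length xs) + scan_cost B Write a (length xs))"
    by (rule ext_sort_base)
  then show ?case
    using mult_scan_cost_le[OF assms(1), of Read a "length xs"] mult_scan_cost_le[OF assms(1), of Write a "length xs"] 0
    by (simp add: distrib_left)
next
  case (Suc D)
  show ?case
  proof (cases "length xs \<le> max 1 M")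
    case True
    then have "ext_sort M B f a xs = (sort_key f xs, scan_cost B Read a (length xs) + scan_cost B Write a (length xs))"
      by (rule ext_sort_base)
    then show ?thesis
      using mult_scan_cost_le[OF assms(1), of Read a "length xs"] mult_scan_cost_le[OF assms(1), of Write a "length xs"] Suc.prems
      by (simp add: distrib_left)
  next
    case False
    define n l where "n = length xs" and "l = n div 2"
    have n: "2 * B \<le> n" "B \<le> l" "B \<le> n - l" "l \<le> 2 ^ D" "n - l \<le> 2 ^ D" "l \<le> n"
      using False assms(2) Suc.prems by (auto simp: n_def l_def)
    have "snd (ext_sort M B f a xs) = snd (ext_sort M B f a (take l xs)) + snd (ext_sort M B f (a + l) (drop l xs))
        + scan_cost B Read a l + scan_cost B Read (a + l) (n - l) + scan_cost B Write a n"
      using False by (simp add: ext_sort_step n_def l_def)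
    then have "B * snd (ext_sort M B f a xs) = B * snd (ext_sort M B f a (take l xs))
        + B * snd (ext_sort M B f (a + l) (drop l xs))
        + B * scan_cost B Read a l + B * scan_cost B Read (a + l) (n - l) + B * scan_cost B Write a n"
      by (simp only: distrib_left)
    moreover have "B * snd (ext_sort M B f a (take l xs)) \<le> 9 * l * (D + 1)"
      using Suc.IH[of "take l xs" a] n by (simp add: n_def)
    moreover have "B * snd (ext_sort M B f (a + l) (drop l xs)) \<le> 9 * (n - l) * (D + 1)"
      using Suc.IH[of "drop l xs" "a + l"] n by (simp add: n_def)
    moreover have "9 * l * (D + 1) + 9 * (n - l) * (D + 1) = 9 * n * (D + 1)"
      using n(6) by (metis add_mult_distrib add_mult_distrib2 le_add_diff_inverse)
    moreover have "9 * n * (Suc D + 1) = 9 * n * (D + 1) + 9 * n" by simp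
    ultimately show ?thesis
      using mult_scan_cost_le[OF assms(1), of Read a l] mult_scan_cost_le[OF assms(1), of Read "a + l" "n - l"]
        mult_scan_cost_le[OF assms(1), of Write a n] n(1,6)
      unfolding n_def[symmetric] dir_cost.simps mult_1_left distrib_left by linarith
  qed
qed

text \<open>One of the two arrays may be shorter than a block; its partial blocks are then charged
  to the total size \<open>N\<close>.\<close>

lemma ext_sort_cost_le:
  assumes "0 < B" "2 * B \<le> M" "length xs \<le> N" "2 * B \<le> N" "N \<le> 2 ^ D"
  shows "B * snd (ext_sort M B f a xs) \<le> 9 * N * (D + 1)"
proof (cases "B \<le> length xs")
  case True
  have "9 * length xs * (D + 1) \<le> 9 * N * (D + 1)"
    using assms by (intro mult_le_mono) auto
  then show ?thesis using ext_sort_cost[OF assms(1,2) True, of D f a] assms by linarith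
next
  case False
  then have "ext_sort M B f a xs = (sort_key f xs, scan_cost B Read a (length xs) + scan_cost B Write a (length xs))"
    using assms by (intro ext_sort_base) simp
  then have "B * snd (ext_sort M B f a xs) = B * scan_cost B Read a (length xs) + B * scan_cost B Write a (length xs)"
    by (simp add: distrib_left)
  moreover have "9 * N \<le> 9 * N * (D + 1)" by simp
  ultimately show ?thesis
    using mult_scan_cost_le[OF assms(1), of Read a "length xs"] mult_scan_cost_le[OF assms(1), of Write a "length xs"] False assms(4)
    unfolding dir_cost.simps mult_1_left distrib_left by linarith
qed

section \<open>One round\<close>

text \<open>The counterpart of \<open>join_effect\<close> for a list of repetitions, with
  \<open>ios\<close> in place of the potential, as each repetition starts with empty frames. The
  remaining budget stays in the inequality, so that all repetitions of a round draw on one initial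
  budget; \<open>K\<close> is the cost per repetition that no pair pays for.\<close>

definition hash_effect ::
  "('a \<Rightarrow> 'a \<Rightarrow> real) \<Rightarrow> real \<Rightarrow> real \<Rightarrow> nat \<Rightarrow> nat \<Rightarrow> nat \<Rightarrow> nat \<Rightarrow> ('a \<Rightarrow> 'v) list
    \<Rightarrow> 'a item list \<times> 'a item list \<times> 'a mach \<Rightarrow> 'a item list \<times> 'a item list \<times> 'a mach \<Rightarrow> bool"
where
  "hash_effect d r c m B T K hs = (\<lambda>(X, Y, s) (X', Y', s').
     points X' \<subseteq># points X \<and> points Y' \<subseteq># points Y \<and>
     counters_le T X' \<and> counters_le T Y' \<and>
     survives T (\<lambda>x. \<Sum>h\<leftarrow>hs. far_count (\<lambda>x y. h x = h y \<and> far d r c (x, y)) Y x) X X' \<and>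
     survives T (\<lambda>y. \<Sum>h\<leftarrow>hs. far_count (\<lambda>y x. h x = h y \<and> far d r c (x, y)) X y) Y Y' \<and>
     emitted s \<subseteq> emitted s' \<and> emitted s' \<subseteq> emitted s \<union> near_pairs d r Arr_R X Y \<and>
     (\<forall>h \<in> set hs. \<forall>x \<in> fst ` set X'. \<forall>y \<in> fst ` set Y'. h x = h y \<longrightarrow> near d r (x, y) \<longrightarrow>
        (x, y) \<in> emitted s') \<and>
     m * B * ios s' + 6 * (budget (T + m) X' + budget (T + m) Y') \<le>
     m * B * ios s + length hs * K + 6 * (budget (T + m) X + budget (T + m) Y +
        (\<Sum>h\<leftarrow>hs. npairs (\<lambda>x y. h x = h y \<and> \<not> far d r c (x, y)) (points X) (points Y))))"

lemma hash_effectD: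
  assumes "hash_effect d r c m B T K hs (X, Y, s) (X', Y', s')"
  shows "points X' \<subseteq># points X" "points Y' \<subseteq># points Y"
    "counters_le T X'" "counters_le T Y'"
    "survives T (\<lambda>x. \<Sum>h\<leftarrow>hs. far_count (\<lambda>x y. h x = h y \<and> far d r c (x, y)) Y x) X X'"
    "survives T (\<lambda>y. \<Sum>h\<leftarrow>hs. far_count (\<lambda>y x. h x = h y \<and> far d r c (x, y)) X y) Y Y'"
    "emitted s \<subseteq> emitted s'" "emitted s' \<subseteq> emitted s \<union> near_pairs d r Arr_R X Y"
    "\<And>h x y. h \<in> set hs \<Longrightarrow> x \<in> fst ` set X' \<Longrightarrow> y \<in> fst ` set Y' \<Longrightarrow> h x = h y \<Longrightarrow> near d r (x, y) \<Longrightarrow>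
        (x, y) \<in> emitted s'"
    "m * B * ios s' + 6 * (budget (T + m) X' + budget (T + m) Y') \<le>
     m * B * ios s + length hs * K + 6 * (budget (T + m) X + budget (T + m) Y +
        (\<Sum>h\<leftarrow>hs. npairs (\<lambda>x y. h x = h y \<and> \<not> far d r c (x, y)) (points X) (points Y)))"
  using assms unfolding hash_effect_def prod.case by - (elim conjE, assumption | elim conjE, blast)+

lemma hash_join_spec:
  assumes B: "0 < B" and M: "2 * B \<le> M"
    and le: "counters_le T X" "counters_le T Y"
    and N: "length X + length Y \<le> N" "2 * B \<le> N" "N \<le> 2 ^ D"
  shows "hash_effect d r c (M div 2) B T (39 * (M div 2) * N * (D + 1)) [h] (X, Y, s)
    (hash_join d r c M B T h (X, Y, s))"
proof -
  define m where "m = M div 2"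
  have M2: "2 \<le> M" and Bm: "B \<le> m" using B M by (simp_all add: m_def)
  obtain X1 i where X1: "ext_sort M B (\<lambda>x. h (fst x)) 0 X = (X1, i)" by fastforce
  obtain Y1 j where Y1: "ext_sort M B (\<lambda>x. h (fst x)) 0 Y = (Y1, j)" by fastforce
  have ms: "mset X1 = mset X" "mset Y1 = mset Y"
    using mset_ext_sort[of M B "\<lambda>x. h (fst x)" 0 X] mset_ext_sort[of M B "\<lambda>x. h (fst x)" 0 Y]
    by (simp_all add: X1 Y1)
  note set1 = ms[THEN mset_eq_setD] and len1 = ms[THEN mset_eq_length]
  have ij: "B * i \<le> 9 * N * (D + 1)" "B * j \<le> 9 * N * (D + 1)"
    using ext_sort_cost_le[OF B M _ N(2,3), of X "\<lambda>x. h (fst x)" 0]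
      ext_sort_cost_le[OF B M _ N(2,3), of Y "\<lambda>x. h (fst x)" 0] N(1)
    by (simp_all add: X1 Y1)
  define vs where "vs = sorted_list_of_set ((\<lambda>x. h (fst x)) ` (set X1 \<union> set Y1))"
  define s1 where "s1 = s\<lparr>frame := (\<lambda>_ _. None), ios := ios s + i + j\<rparr>"
  have vs: "distinct vs" "set vs = (\<lambda>x. h (fst x)) ` (set X1 \<union> set Y1)"
    by (simp_all add: vs_def)
  have filt: "filter (\<lambda>x. h (fst x) \<in> set vs) X1 = X1" "filter (\<lambda>x. h (fst x) \<in> set vs) Y1 = Y1"
    by (auto simp: vs(2) filter_id_conv)
  \<comment> \<open>Empty frames have position 0, so the potential starts as the plain
    count.\<close>
  have net1: "net s1 = int (ios s + i + j)" and em1: "emitted s1 = emitted s"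
    by (simp_all add: s1_def net_def frame_pos_def)
  have conf1: "confined B (case_arr 0 0) s1"
    by (simp add: confined_def s1_def frame_pos_def)
  have le1: "counters_le T X1" "counters_le T Y1"
    using le set1 by (simp_all add: counters_le_def)
  obtain X' Y' s2 where jb: "join_buckets d r c M B T h X1 Y1 vs 0 0 s1 = (X', Y', s2)"
    and eff1: "join_effect d r c m B T Arr_R (\<lambda>x y. h x = h y) 0 X1 Y1 s1 X' Y' s2"
    and conf2: "confined B (case_arr (length X1) (length Y1)) s2"
    using join_buckets_spec[OF B M2 le1 vs(1) conf1, of d r c h]
    unfolding filt m_def[symmetric] add_0_left by blast
  have eff: "join_effect d r c m B T Arr_R (\<lambda>x y. h x = h y) 0 X Y s1 X' Y' s2"
    by (rule join_effect_cong[OF eff1 ms]) simp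
  note eff = join_effectD[OF eff, unfolded orient_def, simplified if_True simp_thms]
  define s' where "s' = s2\<lparr>ios := ios s2
                + scan_cost B Read 0 (length X1) + scan_cost B Write 0 (length X')
                + scan_cost B Read 0 (length Y1) + scan_cost B Write 0 (length Y')\<rparr>"
  have hj: "hash_join d r c M B T h (X, Y, s) = (X', Y', s')"
    using jb by (simp add: hash_join_def X1 Y1 vs_def[symmetric] s1_def[symmetric] s'_def Let_def)
  have em': "emitted s' = emitted s2" by (simp add: s'_def)
  have len': "length X' \<le> length X" "length Y' \<le> length Y"
    using size_mset_mono[OF eff(1)] size_mset_mono[OF eff(2)] by simp_all
  \<comment> \<open>Confinement bounds what the potential hides: weight 1 for reading plus 2 for
    writing, per block of each array.\<close>
  have fp: "frame_pos s2 Arr_R D \<le> Suc (length X div B)" "frame_pos s2 Arr_S D \<le> Suc (length Y div B)" for D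
    using conf2 len1 unfolding confined_def by (metis arr.case)+
  have "int (ios s2) \<le> net s2 + int (3 * Suc (length X div B) + 3 * Suc (length Y div B))"
    using fp[of Read] fp[of Write] by (simp add: net_def)
  then have "int B * int (ios s2) \<le> int B * (net s2 + int (3 * Suc (length X div B) + 3 * Suc (length Y div B)))"
    by (rule mult_left_mono) simp
  also have "\<dots> = int B * net s2 + int (3 * (B * (length X div B)) + 3 * (B * (length Y div B)) + 6 * B)"
    by (simp add: algebra_simps)
  also have "\<dots> \<le> int B * net s2 + int (3 * length X + 3 * length Y + 6 * B)"
    by (intro add_left_mono of_nat_mono add_mono mult_le_mono2) simp_all
  finally have fr: "int (B * ios s2) \<le> int B * net s2 + int (3 * length X + 3 * length Y + 6 * B)"
    by simp
  have "B * ios s' = B * ios s2 + B * scan_cost B Read 0 (length X1) + B * scan_cost B Write 0 (length X')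
                + B * scan_cost B Read 0 (length Y1) + B * scan_cost B Write 0 (length Y')"
    by (simp add: s'_def distrib_left)
  also have "\<dots> \<le> B * ios s2 + 3 * (length X + 2 * B) + 3 * (length Y + 2 * B)"
    using mult_scan_cost_le[OF B, of Read 0 "length X1"] mult_scan_cost_le[OF B, of Write 0 "length X'"]
      mult_scan_cost_le[OF B, of Read 0 "length Y1"] mult_scan_cost_le[OF B, of Write 0 "length Y'"] len' len1
    unfolding dir_cost.simps mult_1_left distrib_left by linarith
  finally have "int (B * ios s') \<le> int (B * ios s2 + 3 * (length X + 2 * B) + 3 * (length Y + 2 * B))"
    by (rule of_nat_mono)
  then have "int (B * ios s') \<le> int (B * ios s2) + int (3 * (length X + 2 * B) + 3 * (length Y + 2 * B))"
    by (simp only: of_nat_add add.assoc)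
  \<comment> \<open>The frame terms are at most \<open>6 * N\<close> and the closing scans at most
    \<open>9 * N\<close>, by \<open>2 * B \<le> N\<close>.\<close>
  moreover have "int (3 * length X + 3 * length Y + 6 * B) + int (3 * (length X + 2 * B) + 3 * (length Y + 2 * B))
      \<le> int (15 * N)"
    unfolding of_nat_add[symmetric] of_nat_le_iff distrib_left using N(1,2) by linarith
  ultimately have "int (B * ios s') \<le> int B * net s2 + int (15 * N)"
    using fr by linarith
  then have "int m * int (B * ios s') \<le> int m * (int B * net s2 + int (15 * N))"
    by (rule mult_left_mono) simp
  then have c1: "int (m * B * ios s') \<le> int (m * B) * net s2 + int (m * (15 * N))"
    by (simp add: distrib_left mult.assoc)
  have "m * (B * i) + m * (B * j) \<le> m * (9 * N * (D + 1)) + m * (9 * N * (D + 1))"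
    using ij by (intro add_mono mult_le_mono2)
  moreover have "B * (length X + length Y) \<le> m * N"
    using Bm N by (intro mult_le_mono)
  moreover have "m * N \<le> m * N * (D + 1)" by simp
  moreover have "m * (9 * N * (D + 1)) = 9 * (m * N * (D + 1))" "m * (15 * N) = 15 * (m * N)"
    by (simp_all only: mult_ac)
  \<comment> \<open>39 is \<open>9 + 9\<close> for the two sorts, 6 for the length term of
    \<open>join_effect\<close> by \<open>B \<le> m\<close>, and 15 for frames and closing
    scans.\<close>
  ultimately have c2: "m * (B * i) + m * (B * j) + 6 * (B * (length X + length Y)) + m * (15 * N)
      \<le> 39 * (m * N * (D + 1))" by linarith
  define np where "np = npairs (\<lambda>x y. h x = h y \<and> \<not> far d r c (x, y)) (points X) (points Y)"
  have "int (m * B) * net s1 = int (m * B * ios s + m * (B * i) + m * (B * j))"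
    by (simp add: net1 distrib_left mult.assoc)
  then have c3: "int (m * B) * net s2 + int (6 * (budget (T + m) X' + budget (T + m) Y')) \<le>
     int (m * B * ios s + m * (B * i) + m * (B * j)) + int (6 * (budget (T + m) X + budget (T + m) Y +
        np + B * (length X + length Y)))"
    using eff(10) by (simp add: np_def)
  have c4: "(m * B * ios s + m * (B * i) + m * (B * j)) + 6 * (budget (T + m) X + budget (T + m) Y +
        np + B * (length X + length Y)) + m * (15 * N)
      \<le> m * B * ios s + 39 * (m * N * (D + 1)) + 6 * (budget (T + m) X + budget (T + m) Y + np)"
    unfolding distrib_left[of 6] using c2 unfolding distrib_left[of 6] by linarith
  have combine: "u + p \<le> t"
    if "int u \<le> z + int k" "z + int p \<le> int l + int q" "l + q + k \<le> t"
    for z :: int and u k l p q t :: nat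
    using that by linarith
  have "m * B * ios s' + 6 * (budget (T + m) X' + budget (T + m) Y') \<le>
     m * B * ios s + 39 * (m * N * (D + 1)) + 6 * (budget (T + m) X + budget (T + m) Y + np)"
    by (rule combine[OF c1 c3 c4])
  then have "m * B * ios s' + 6 * (budget (T + m) X' + budget (T + m) Y') \<le>
     m * B * ios s + 39 * m * N * (D + 1) + 6 * (budget (T + m) X + budget (T + m) Y + np)"
    by (simp only: mult.assoc)
  then show ?thesis
    unfolding hash_effect_def hj prod.case m_def[symmetric] em' using eff(1-9) em1
    by (simp add: np_def)
qed

lemma hash_effect_Nil: "counters_le T X \<Longrightarrow> counters_le T Y \<Longrightarrow> hash_effect d r c m B T K [] (X, Y, s) (X, Y, s)"
  by (simp add: hash_effect_def survives_refl)

text \<open>Later repetitions work on what earlier ones left. Far counts and compared pairs are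
  monotone, so they may be taken over the lists at the start, which frees the bound from the history
  of the run.\<close>

lemma hash_effect_Cons:
  assumes e1: "hash_effect d r c m B T K [h] (X, Y, s) (X1, Y1, s1)"
    and e2: "hash_effect d r c m B T K hs (X1, Y1, s1) (X', Y', s')"
  shows "hash_effect d r c m B T K (h # hs) (X, Y, s) (X', Y', s')"
proof -
  note e1 = hash_effectD[OF e1] and e2 = hash_effectD[OF e2]
  let ?q = "\<lambda>h x y. h x = h y \<and> far d r c (x, y)"
  have pts: "points X' \<subseteq># points X" "points Y' \<subseteq># points Y"
    by (rule subset_mset.order_trans[OF e2(1) e1(1)], rule subset_mset.order_trans[OF e2(2) e1(2)])
  have "survives T (\<lambda>x. \<Sum>h\<leftarrow>hs. far_count (?q h) Y x) X1 X'"
    by (rule survives_mono[OF e2(5)]) (intro sum_list_mono far_count_mono e1)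
  from survives_trans[OF e1(5) this]
  have sX: "survives T (\<lambda>x. \<Sum>h\<leftarrow>h#hs. far_count (?q h) Y x) X X'" by simp
  have "survives T (\<lambda>y. \<Sum>h\<leftarrow>hs. far_count (\<lambda>y x. ?q h x y) X y) Y1 Y'"
    by (rule survives_mono[OF e2(6)]) (intro sum_list_mono far_count_mono e1)
  from survives_trans[OF e1(6) this]
  have sY: "survives T (\<lambda>y. \<Sum>h\<leftarrow>h#hs. far_count (\<lambda>y x. ?q h x y) X y) Y Y'" by simp
  have em: "emitted s \<subseteq> emitted s'" using e1(7) e2(7) by blast
  have "near_pairs d r Arr_R X1 Y1 \<subseteq> near_pairs d r Arr_R X Y"
    by (intro near_pairs_mono points_mono_set e1)
  then have em': "emitted s' \<subseteq> emitted s \<union> near_pairs d r Arr_R X Y"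
    using e1(8) e2(8) by blast
  have compl: "\<forall>h \<in> set (h # hs). \<forall>x \<in> fst ` set X'. \<forall>y \<in> fst ` set Y'. h x = h y \<longrightarrow> near d r (x, y) \<longrightarrow>
        (x, y) \<in> emitted s'"
  proof (intro ballI impI)
    fix g x y assume g: "g \<in> set (h # hs)" "x \<in> fst ` set X'" "y \<in> fst ` set Y'" "g x = g y" "near d r (x, y)"
    show "(x, y) \<in> emitted s'"
    proof (cases "g = h")
      case True
      have "x \<in> fst ` set X1" "y \<in> fst ` set Y1"
        using subsetD[OF points_mono_set[OF e2(1)] g(2)] subsetD[OF points_mono_set[OF e2(2)] g(3)] by blast+
      then have "(x, y) \<in> emitted s1" using e1(9)[of h x y] g True by simp
      then show ?thesis using e2(7) by blast
    next
      case False
      then show ?thesis using e2(9) g by simp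
    qed
  qed
  have "(\<Sum>h\<leftarrow>hs. npairs (\<lambda>x y. h x = h y \<and> \<not> far d r c (x, y)) (points X1) (points Y1)) \<le>
    (\<Sum>h\<leftarrow>hs. npairs (\<lambda>x y. h x = h y \<and> \<not> far d r c (x, y)) (points X) (points Y))"
    by (intro sum_list_mono npairs_mono e1)
  then have "m * B * ios s' + 6 * (budget (T + m) X' + budget (T + m) Y') \<le>
     m * B * ios s + length (h # hs) * K + 6 * (budget (T + m) X + budget (T + m) Y +
        (\<Sum>h\<leftarrow>h # hs. npairs (\<lambda>x y. h x = h y \<and> \<not> far d r c (x, y)) (points X) (points Y)))"
    using e1(10) e2(10) by simp
  then show ?thesis
    unfolding hash_effect_def prod.case using pts e2(3,4) sX sY em em' compl by (intro conjI)
qed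

lemma fold_hash_join_spec:
  assumes "0 < B" "2 * B \<le> M" "counters_le T X" "counters_le T Y"
    and "length X + length Y \<le> N" "2 * B \<le> N" "N \<le> 2 ^ D"
  shows "hash_effect d r c (M div 2) B T (39 * (M div 2) * N * (D + 1)) hs (X, Y, s)
    (fold (hash_join d r c M B T) hs (X, Y, s))"
  using assms
proof (induction hs arbitrary: X Y s)
  case Nil
  then show ?case by (simp add: hash_effect_Nil)
next
  case (Cons h hs)
  obtain X1 Y1 s1 where 1: "hash_join d r c M B T h (X, Y, s) = (X1, Y1, s1)"
    by (metis surj_pair)
  obtain X' Y' s' where 2: "fold (hash_join d r c M B T) hs (X1, Y1, s1) = (X', Y', s')"
    by (metis surj_pair)
  note e1 = hash_join_spec[OF Cons.prems, of d r c h s, unfolded 1]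
  have "length X1 \<le> length X" "length Y1 \<le> length Y"
    using size_mset_mono[OF hash_effectD(1)[OF e1]] size_mset_mono[OF hash_effectD(2)[OF e1]] by simp_all
  then have "length X1 + length Y1 \<le> N" using Cons.prems by linarith
  from Cons.IH[OF Cons.prems(1,2) hash_effectD(3,4)[OF e1] this Cons.prems(6,7), of s1, unfolded 2]
  have "hash_effect d r c (M div 2) B T (39 * (M div 2) * N * (D + 1)) (h # hs) (X, Y, s) (X', Y', s')"
    by (rule hash_effect_Cons[OF e1])
  then show ?case by (simp add: 1 2)
qed

section \<open>A round for fixed hash functions\<close>

definition det_round ::
  "('a \<Rightarrow> 'a \<Rightarrow> real) \<Rightarrow> real \<Rightarrow> real \<Rightarrow> nat \<Rightarrow> nat \<Rightarrow> nat \<Rightarrow> 'a list \<Rightarrow> 'a list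
    \<Rightarrow> ('a \<Rightarrow> 'v::linorder) list \<Rightarrow> 'a mach \<Rightarrow> 'a mach" where
  "det_round d r c M B T xs ys hs s =
     snd (snd (fold (hash_join d r c M B T) hs
       (map (\<lambda>x. (x, 0)) xs, map (\<lambda>y. (y, 0)) ys,
        s\<lparr>ios := ios s
                + scan_cost B Read 0 (length xs) + scan_cost B Write 0 (length xs)
                + scan_cost B Read 0 (length ys) + scan_cost B Write 0 (length ys)\<rparr>)))"

text \<open>Counts against the whole input, removed points included. Its expectation thus follows
  from collision probabilities alone, unlike that of an actual counter.\<close>

definition far_collisions :: "('a \<Rightarrow> 'a \<Rightarrow> real) \<Rightarrow> real \<Rightarrow> 'a set \<Rightarrow> 'a \<Rightarrow> ('a \<Rightarrow> 'v) \<Rightarrow> nat" where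
  "far_collisions d t S x h = card {y \<in> S. t < d x y \<and> h x = h y}"

definition mid_pairs :: "('a \<Rightarrow> 'a \<Rightarrow> real) \<Rightarrow> real \<Rightarrow> real \<Rightarrow> 'a set \<Rightarrow> 'a set \<Rightarrow> ('a \<times> 'a) set" where
  "mid_pairs d r t R S = {(x, y) \<in> R \<times> S. r < d x y \<and> d x y \<le> t}"

definition mid_collisions ::
  "('a \<Rightarrow> 'a \<Rightarrow> real) \<Rightarrow> real \<Rightarrow> real \<Rightarrow> 'a set \<Rightarrow> 'a set \<Rightarrow> ('a \<Rightarrow> 'v) \<Rightarrow> nat" where
  "mid_collisions d r t R S h = card {p \<in> mid_pairs d r t R S. h (fst p) = h (snd p)}"

lemma points_map_0 [simp]: "points (map (\<lambda>x. (x, 0)) xs) = mset xs"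
  by (simp add: points_def comp_def)

lemma budget_map_0: "budget K (map (\<lambda>x. (x, 0)) xs) = length xs * K"
  by (induction xs) (simp_all add: budget_def)

text \<open>Near pairs are charged in every repetition, which yields the factor
  \<open>length hs\<close> on the join. Pairs at distance between \<open>r\<close> and
  \<open>c * r\<close> must not carry that factor, so they are charged only when they collide. The
  budget is \<open>N * (T + m)\<close>, as all counters start at 0.\<close>

lemma det_round_spec:
  fixes d :: "'a \<Rightarrow> 'a \<Rightarrow> real" and r c :: real and M B N T :: nat and xs ys :: "'a list"
    and hs :: "('a \<Rightarrow> 'v::linorder) list" and s :: "'a mach"
  assumes B: "0 < B" "2 * B \<le> M" and xs: "distinct xs" "distinct ys"
    and N: "length xs + length ys = N" "2 * B \<le> N" "N \<le> 2 ^ D"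
  defines "m \<equiv> M div 2"
  defines "s' \<equiv> det_round d r c M B T xs ys hs s"
  shows "emitted s \<subseteq> emitted s'" (is ?A)
    and "emitted s' \<subseteq> emitted s \<union> sim_join d r (set xs) (set ys)" (is ?B)
    and "\<And>x y h. (x, y) \<in> sim_join d r (set xs) (set ys) \<Longrightarrow> h \<in> set hs \<Longrightarrow> h x = h y \<Longrightarrow>
        (\<Sum>h\<leftarrow>hs. far_collisions d (c * r) (set ys) x h) \<le> T \<Longrightarrow>
        (\<Sum>h\<leftarrow>hs. far_collisions (\<lambda>y x. d x y) (c * r) (set xs) y h) \<le> T \<Longrightarrow> (x, y) \<in> emitted s'"
      (is "PROP ?C")
    and "m * B * ios s' \<le> m * B * ios s + 9 * m * N + length hs * (39 * m * N * (D + 1))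
        + 6 * (N * (T + m) + length hs * card (sim_join d r (set xs) (set ys))
          + (\<Sum>h\<leftarrow>hs. mid_collisions d r (c * r) (set xs) (set ys) h))" (is ?D)
proof -
  let ?X = "map (\<lambda>x. (x, 0::nat)) xs" and ?Y = "map (\<lambda>y. (y, 0::nat)) ys"
  define s0 where "s0 = s\<lparr>ios := ios s
                + scan_cost B Read 0 (length xs) + scan_cost B Write 0 (length xs)
                + scan_cost B Read 0 (length ys) + scan_cost B Write 0 (length ys)\<rparr>"
  have em0: "emitted s0 = emitted s" by (simp add: s0_def)
  obtain X' Y' where res: "fold (hash_join d r c M B T) hs (?X, ?Y, s0) = (X', Y', s')"
    unfolding s'_def det_round_def s0_def[symmetric] by (metis prod.collapse)
  have "counters_le T ?X" "counters_le T ?Y" "length ?X + length ?Y \<le> N"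
    using N by (auto simp: counters_le_def)
  from fold_hash_join_spec[OF B this N(2,3), of d r c hs s0, unfolded res]
  have "hash_effect d r c m B T (39 * m * N * (D + 1)) hs (?X, ?Y, s0) (X', Y', s')"
    unfolding m_def .
  note e = hash_effectD[OF this]
  show ?A using e(7) em0 by simp
  have np: "near_pairs d r Arr_R ?X ?Y = sim_join d r (set xs) (set ys)"
    unfolding near_pairs_def near_def sim_join_def orient_def by force
  show ?B using e(8) em0 np by simp
  have mset: "mset xs = mset_set (set xs)" "mset ys = mset_set (set ys)"
    using xs by (simp_all add: mset_set_set)
  have fc: "far_count (\<lambda>x y. h x = h y \<and> far d r c (x, y)) ?Y = (\<lambda>x. far_collisions d (c * r) (set ys) x h)"
    "far_count (\<lambda>y x. h x = h y \<and> far d r c (x, y)) ?X = (\<lambda>y. far_collisions (\<lambda>y x. d x y) (c * r) (set xs) y h)"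
    for h :: "'a \<Rightarrow> 'v"
    unfolding far_count_def far_collisions_def points_map_0 mset far_def
    by (auto simp: fun_eq_iff filter_mset_mset_set intro!: arg_cong[of _ _ card])
  show "PROP ?C"
  proof -
    fix x y h assume xy: "(x, y) \<in> sim_join d r (set xs) (set ys)" "h \<in> set hs" "h x = h y"
      and T: "(\<Sum>h\<leftarrow>hs. far_collisions d (c * r) (set ys) x h) \<le> T"
        "(\<Sum>h\<leftarrow>hs. far_collisions (\<lambda>y x. d x y) (c * r) (set xs) y h) \<le> T"
    \<comment> \<open>With a counter starting at 0, an allowance of at most \<open>T\<close> means
      survival.\<close>
    have "(x, 0) \<in> set ?X" "(y, 0) \<in> set ?Y" and near: "near d r (x, y)"
      using xy by (auto simp: sim_join_def near_def)
    with e(5,6) T have "\<exists>k. (x, k) \<in> set X'" "\<exists>k. (y, k) \<in> set Y'"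
      unfolding survives_def fc by fastforce+
    then have "x \<in> fst ` set X'" "y \<in> fst ` set Y'" by force+
    then show "(x, y) \<in> emitted s'" using e(9) xy near by blast
  qed
  have np_le: "npairs (\<lambda>x y. h x = h y \<and> \<not> far d r c (x, y)) (points ?X) (points ?Y)
      \<le> card (sim_join d r (set xs) (set ys)) + mid_collisions d r (c * r) (set xs) (set ys) h" for h :: "'a \<Rightarrow> 'v"
  proof -
    let ?P = "{p \<in> mid_pairs d r (c * r) (set xs) (set ys). h (fst p) = h (snd p)}"
    have fin: "finite (sim_join d r (set xs) (set ys))" "finite ?P"
      by (auto simp: sim_join_def mid_pairs_def intro: finite_subset[of _ "set xs \<times> set ys"])
    have "npairs (\<lambda>x y. h x = h y \<and> \<not> far d r c (x, y)) (points ?X) (points ?Y)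
      = card {(x, y). x \<in> set xs \<and> y \<in> set ys \<and> h x = h y \<and> \<not> far d r c (x, y)}"
      unfolding points_map_0 mset by (rule npairs_mset_set) simp_all
    also have "\<dots> \<le> card (sim_join d r (set xs) (set ys) \<union> ?P)"
      using fin by (intro card_mono) (auto simp: sim_join_def mid_pairs_def far_def)
    also have "\<dots> \<le> card (sim_join d r (set xs) (set ys)) + card ?P" by (rule card_Un_le)
    finally show ?thesis by (simp add: mid_collisions_def)
  qed
  have "(\<Sum>h\<leftarrow>hs. npairs (\<lambda>x y. h x = h y \<and> \<not> far d r c (x, y)) (points ?X) (points ?Y))
      \<le> (\<Sum>h\<leftarrow>hs. card (sim_join d r (set xs) (set ys)) + mid_collisions d r (c * r) (set xs) (set ys) h)"
    by (intro sum_list_mono np_le)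
  also have "\<dots> = length hs * card (sim_join d r (set xs) (set ys))
       + (\<Sum>h\<leftarrow>hs. mid_collisions d r (c * r) (set xs) (set ys) h)"
    by (simp add: sum_list_addf sum_list_triv)
  finally have c1: "(\<Sum>h\<leftarrow>hs. npairs (\<lambda>x y. h x = h y \<and> \<not> far d r c (x, y)) (points ?X) (points ?Y)) \<le> \<dots>" .
  have "B * ios s0 = B * ios s + B * scan_cost B Read 0 (length xs) + B * scan_cost B Write 0 (length xs)
                + B * scan_cost B Read 0 (length ys) + B * scan_cost B Write 0 (length ys)"
    by (simp add: s0_def distrib_left)
  \<comment> \<open>Copying both inputs costs at most \<open>3 * N + 12 * B\<close>, hence at most
    \<open>9 * N\<close>.\<close>
  then have "B * ios s0 \<le> B * ios s + 9 * N"
    using mult_scan_cost_le[OF B(1), of Read 0 "length xs"] mult_scan_cost_le[OF B(1), of Write 0 "length xs"]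
      mult_scan_cost_le[OF B(1), of Read 0 "length ys"] mult_scan_cost_le[OF B(1), of Write 0 "length ys"] N
    unfolding dir_cost.simps mult_1_left distrib_left by linarith
  then have "m * (B * ios s0) \<le> m * (B * ios s + 9 * N)" by (rule mult_le_mono2)
  then have c2: "m * B * ios s0 \<le> m * B * ios s + 9 * m * N" by (simp add: algebra_simps)
  have c3: "budget (T + m) ?X + budget (T + m) ?Y = N * (T + m)"
    unfolding budget_map_0 N(1)[symmetric] by (simp only: distrib_right)
  show ?D using e(10) c1 c2 unfolding c3 distrib_left[of 6] by linarith
qed

section \<open>Probability\<close>

text \<open>No draw depends on the state, so all draws can precede the run.\<close>

lemma repeat_pmf_map_pmf:
  "repeat_pmf n (\<lambda>s. map_pmf (\<lambda>h. F h s) p) s = map_pmf (\<lambda>hs. fold F hs s) (replicate_pmf n p)"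
proof (induction n arbitrary: s)
  case (Suc n)
  then show ?case
    by (simp add: bind_map_pmf map_bind_pmf map_pmf_def bind_assoc_pmf bind_return_pmf)
qed simp

lemma asimjoin_round_eq:
  "asimjoin_round d r c M B H L xs ys s =
     map_pmf (\<lambda>hs. det_round d r c M B (8 * L * M) xs ys hs s) (replicate_pmf L (pmf_of_set H))"
  unfolding asimjoin_round_def repeat_pmf_map_pmf map_pmf_comp det_round_def
  by (simp add: split_def)

lemma asimjoin_eq:
  "asimjoin d r c M B H p1 xs ys =
     map_pmf (\<lambda>hss. fold (det_round d r c M B (8 * nat \<lceil>2 / p1\<rceil> * M) xs ys) hss
         \<lparr>frame = (\<lambda>_ _. None), ios = 0, emitted = {}\<rparr>)
       (replicate_pmf (nat \<lceil>3 * log 2 (real (length xs + length ys))\<rceil>)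
         (replicate_pmf (nat \<lceil>2 / p1\<rceil>) (pmf_of_set H)))"
  unfolding asimjoin_def asimjoin_round_eq[abs_def] repeat_pmf_map_pmf ..

text \<open>Each round starts with fresh copies, so the budget is charged once per round. Emitted
  pairs stay emitted, so one round with suitable functions suffices for a pair.\<close>

lemma fold_det_round_spec:
  fixes d :: "'a \<Rightarrow> 'a \<Rightarrow> real" and r c :: real and M B N T :: nat and xs ys :: "'a list"
    and hss :: "('a \<Rightarrow> 'v::linorder) list list" and s :: "'a mach"
  assumes B: "0 < B" "2 * B \<le> M" and xs: "distinct xs" "distinct ys"
    and N: "length xs + length ys = N" "2 * B \<le> N" "N \<le> 2 ^ D"
    and L: "\<forall>hs \<in> set hss. length hs = L"
  defines "m \<equiv> M div 2" and "J \<equiv> sim_join d r (set xs) (set ys)"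
  shows "emitted s \<subseteq> emitted (fold (det_round d r c M B T xs ys) hss s) \<and>
    emitted (fold (det_round d r c M B T xs ys) hss s) \<subseteq> emitted s \<union> J \<and>
    (\<forall>(x, y) \<in> J. \<forall>hs \<in> set hss. (\<exists>h \<in> set hs. h x = h y) \<longrightarrow>
        (\<Sum>h\<leftarrow>hs. far_collisions d (c * r) (set ys) x h) \<le> T \<longrightarrow>
        (\<Sum>h\<leftarrow>hs. far_collisions (\<lambda>y x. d x y) (c * r) (set xs) y h) \<le> T \<longrightarrow>
        (x, y) \<in> emitted (fold (det_round d r c M B T xs ys) hss s)) \<and>
    m * B * ios (fold (det_round d r c M B T xs ys) hss s) \<le> m * B * ios s
        + length hss * (9 * m * N + L * (39 * m * N * (D + 1)) + 6 * (N * (T + m) + L * card J))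
        + 6 * (\<Sum>hs\<leftarrow>hss. \<Sum>h\<leftarrow>hs. mid_collisions d r (c * r) (set xs) (set ys) h)"
  using L
proof (induction hss arbitrary: s)
  case Nil
  then show ?case by simp
next
  case (Cons hs hss)
  let ?s1 = "det_round d r c M B T xs ys hs s"
  let ?s' = "fold (det_round d r c M B T xs ys) hss ?s1"
  let ?mid = "\<lambda>hs. \<Sum>h\<leftarrow>hs. mid_collisions d r (c * r) (set xs) (set ys) h"
  note rd = det_round_spec[OF B xs N, where d = d and r = r and c = c and T = T and hs = hs and s = s,
      folded m_def J_def]
  have "\<forall>hs \<in> set hss. length hs = L" and len: "length hs = L" using Cons.prems by simp_all
  note IH = Cons.IH[OF this(1), of ?s1]
  have em: "emitted s \<subseteq> emitted ?s'" "emitted ?s' \<subseteq> emitted s \<union> J" "emitted ?s1 \<subseteq> emitted ?s'"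
    using IH rd(1,2) by blast+
  have compl: "(x, y) \<in> emitted ?s'"
    if xy: "(x, y) \<in> J" and gs: "gs \<in> set (hs # hss)" "\<exists>h \<in> set gs. h x = h y"
      "(\<Sum>h\<leftarrow>gs. far_collisions d (c * r) (set ys) x h) \<le> T"
      "(\<Sum>h\<leftarrow>gs. far_collisions (\<lambda>y x. d x y) (c * r) (set xs) y h) \<le> T" for x y gs
  proof (cases "gs = hs")
    case True
    then have "(x, y) \<in> emitted ?s1" using rd(3) xy gs by blast
    then show ?thesis using em by blast
  next
    case False
    then have "gs \<in> set hss" using gs(1) by simp
    then show ?thesis using IH xy gs(2-4) by blast
  qed
  define w where "w = 9 * m * N + L * (39 * m * N * (D + 1)) + 6 * (N * (T + m) + L * card J)"
  have "m * B * ios ?s' \<le> m * B * ios ?s1 + length hss * w + 6 * (\<Sum>hs\<leftarrow>hss. ?mid hs)"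
    using IH unfolding w_def by blast
  moreover have "m * B * ios ?s1 \<le> m * B * ios s + w + 6 * ?mid hs"
    using rd(4) unfolding w_def len distrib_left[of 6] by linarith
  ultimately have "m * B * ios ?s' \<le> m * B * ios s + length (hs # hss) * w + 6 * (\<Sum>hs\<leftarrow>hs # hss. ?mid hs)"
    by simp
  moreover have "\<forall>(x, y) \<in> J. \<forall>gs \<in> set (hs # hss). (\<exists>h \<in> set gs. h x = h y) \<longrightarrow>
        (\<Sum>h\<leftarrow>gs. far_collisions d (c * r) (set ys) x h) \<le> T \<longrightarrow>
        (\<Sum>h\<leftarrow>gs. far_collisions (\<lambda>y x. d x y) (c * r) (set xs) y h) \<le> T \<longrightarrow> (x, y) \<in> emitted ?s'"
    by (intro ballI, clarify, rule compl) auto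
  ultimately show ?case
    using em unfolding w_def fold_Cons comp_apply by (intro conjI)
qed

section \<open>Integrals over independent draws\<close>

text \<open>Independence as a product formula, in \<open>ennreal\<close> to avoid integrability
  conditions. With indicators for \<open>f\<close> it gives probabilities, with exponentials it
  gives moment generating functions.\<close>

lemma nn_integral_replicate_pmf_prod:
  fixes f :: "'a \<Rightarrow> ennreal"
  shows "(\<integral>\<^sup>+xs. (\<Prod>x\<leftarrow>xs. f x) \<partial>measure_pmf (replicate_pmf n p)) = (\<integral>\<^sup>+x. f x \<partial>measure_pmf p) ^ n"
  by (induction n) (simp_all add: nn_integral_bind_pmf nn_integral_return_pmf nn_integral_cmult nn_integral_multc)

lemma nn_integral_replicate_pmf_sum:
  fixes f :: "'a \<Rightarrow> ennreal"
  shows "(\<integral>\<^sup>+xs. (\<Sum>x\<leftarrow>xs. f x) \<partial>measure_pmf (replicate_pmf n p)) = of_nat n * (\<integral>\<^sup>+x. f x \<partial>measure_pmf p)"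
  by (induction n)
    (simp_all add: nn_integral_bind_pmf nn_integral_return_pmf nn_integral_add distrib_right measure_pmf.emeasure_space_1)

lemma prob_replicate_pmf_all:
  "measure_pmf.prob (replicate_pmf n p) {xs. \<forall>x \<in> set xs. P x} = measure_pmf.prob p {x. P x} ^ n"
proof -
  have "emeasure (measure_pmf (replicate_pmf n p)) {xs. \<forall>x \<in> set xs. P x}
      = (\<integral>\<^sup>+xs. indicator {xs. \<forall>x \<in> set xs. P x} xs \<partial>measure_pmf (replicate_pmf n p))"
    by simp
  also have "\<dots> = (\<integral>\<^sup>+xs. (\<Prod>x\<leftarrow>xs. indicator {x. P x} x) \<partial>measure_pmf (replicate_pmf n p))"
  proof (intro nn_integral_cong)
    show "indicator {xs. \<forall>x \<in> set xs. P x} xs = (\<Prod>x\<leftarrow>xs. indicator {x. P x} x :: ennreal)" for xs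
      by (induction xs) (simp_all add: indicator_def of_bool_conj)
  qed
  also have "\<dots> = emeasure (measure_pmf p) {x. P x} ^ n"
    by (simp add: nn_integral_replicate_pmf_prod)
  finally show ?thesis
    by (simp add: measure_pmf.emeasure_eq_measure ennreal_power)
qed

lemma pmf_markov:
  assumes "(\<integral>\<^sup>+x. f x \<partial>measure_pmf p) \<le> ennreal a" "0 < t" "0 \<le> a"
  shows "measure_pmf.prob p {x. ennreal t \<le> f x} \<le> a / t"
proof -
  have "emeasure (measure_pmf p) {x. ennreal t \<le> f x} \<le> emeasure (measure_pmf p) {x \<in> UNIV. 1 \<le> ennreal (1 / t) * f x}"
  proof (intro emeasure_mono)
    show "{x. ennreal t \<le> f x} \<subseteq> {x \<in> UNIV. 1 \<le> ennreal (1 / t) * f x}"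
    proof (intro subsetI CollectI conjI UNIV_I)
      fix x assume "x \<in> {x. ennreal t \<le> f x}"
      then have "ennreal t \<le> f x" by simp
      then have "ennreal (1 / t) * ennreal t \<le> ennreal (1 / t) * f x" by (rule mult_left_mono) simp
      then show "1 \<le> ennreal (1 / t) * f x" using assms(2) by (simp flip: ennreal_mult')
    qed
  qed simp
  also have "\<dots> \<le> ennreal (1 / t) * (\<integral>\<^sup>+x. f x * indicator UNIV x \<partial>measure_pmf p)"
    by (rule nn_integral_Markov_inequality) simp_all
  also have "\<dots> \<le> ennreal (1 / t) * ennreal a"
    using assms(1) by (intro mult_left_mono) simp_all
  also have "\<dots> = ennreal (a / t)"
    using assms by (simp flip: ennreal_mult')
  finally show ?thesis
    using assms by (simp add: measure_pmf.emeasure_eq_measure)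
qed

lemma nn_integral_card_pmf:
  assumes "finite A"
  shows "(\<integral>\<^sup>+h. of_nat (card {a \<in> A. P a h}) \<partial>measure_pmf p) = ennreal (\<Sum>a\<in>A. measure_pmf.prob p {h. P a h})"
proof -
  have "(\<integral>\<^sup>+h. of_nat (card {a \<in> A. P a h}) \<partial>measure_pmf p)
      = (\<integral>\<^sup>+h. (\<Sum>a\<in>A. indicator {h. P a h} h) \<partial>measure_pmf p)"
    using assms by (intro nn_integral_cong) (simp add: indicator_def sum.If_cases Int_def)
  also have "\<dots> = (\<Sum>a\<in>A. emeasure (measure_pmf p) {h. P a h})"
    by (subst nn_integral_sum) simp_all
  also have "\<dots> = ennreal (\<Sum>a\<in>A. measure_pmf.prob p {h. P a h})"
    by (simp add: measure_pmf.emeasure_eq_measure)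
  finally show ?thesis .
qed

section \<open>Bad events\<close>

lemma prob_far_collisions:
  assumes S: "finite S" and M: "real (card S) * p2 \<le> real M" "0 < M" "0 < L"
    and p2: "\<And>y. y \<in> S \<Longrightarrow> t < d x y \<Longrightarrow> collision_prob H x y \<le> p2"
    and p2_nonneg: "0 \<le> p2"
  shows "measure_pmf.prob (replicate_pmf L (pmf_of_set H))
    {hs. \<not> (\<Sum>h\<leftarrow>hs. far_collisions d t S x h) \<le> 8 * L * M} \<le> 1 / 8"
proof -
  let ?S = "{y \<in> S. t < d x y}"
  have "(\<integral>\<^sup>+h. of_nat (far_collisions d t S x h) \<partial>measure_pmf (pmf_of_set H))
      = (\<integral>\<^sup>+h. of_nat (card {y \<in> ?S. h x = h y}) \<partial>measure_pmf (pmf_of_set H))"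
    by (simp add: far_collisions_def conj_assoc)
  also have "\<dots> = ennreal (\<Sum>y\<in>?S. collision_prob H x y)"
    using S by (subst nn_integral_card_pmf) (simp_all add: collision_prob_def)
  also have "(\<Sum>y\<in>?S. collision_prob H x y) \<le> real (card ?S) * p2"
    using p2 by (intro sum_bounded_above) auto
  also have "\<dots> \<le> real (card S) * p2"
    using S p2_nonneg by (intro mult_right_mono) (auto intro: card_mono)
  finally have 1: "(\<integral>\<^sup>+h. of_nat (far_collisions d t S x h) \<partial>measure_pmf (pmf_of_set H)) \<le> ennreal (real M)"
    using M(1) by (meson ennreal_leI order_trans)
  have "(\<integral>\<^sup>+hs. (\<Sum>h\<leftarrow>hs. of_nat (far_collisions d t S x h)) \<partial>measure_pmf (replicate_pmf L (pmf_of_set H)))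
      \<le> of_nat L * ennreal (real M)"
    unfolding nn_integral_replicate_pmf_sum by (intro mult_left_mono 1) simp
  also have "\<dots> = ennreal (real L * real M)"
    by (simp add: ennreal_mult ennreal_of_nat_eq_real_of_nat)
  finally have "measure_pmf.prob (replicate_pmf L (pmf_of_set H))
      {hs. ennreal (real (8 * L * M)) \<le> (\<Sum>h\<leftarrow>hs. of_nat (far_collisions d t S x h))} \<le> real L * real M / real (8 * L * M)"
    using M by (intro pmf_markov) simp_all
  also have "\<dots> = 1 / 8" using M by simp
  finally have 2: "measure_pmf.prob (replicate_pmf L (pmf_of_set H))
      {hs. ennreal (real (8 * L * M)) \<le> (\<Sum>h\<leftarrow>hs. of_nat (far_collisions d t S x h))} \<le> 1 / 8" .
  have 3: "(\<Sum>h\<leftarrow>hs. of_nat (far_collisions d t S x h)) = (of_nat (\<Sum>h\<leftarrow>hs. far_collisions d t S x h) :: ennreal)" for hs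
    by (induction hs) simp_all
  have 4: "ennreal (real a) \<le> (of_nat b :: ennreal) \<longleftrightarrow> a \<le> b" for a b :: nat
    by (simp add: ennreal_of_nat_eq_real_of_nat)
  have "measure_pmf.prob (replicate_pmf L (pmf_of_set H)) {hs. \<not> (\<Sum>h\<leftarrow>hs. far_collisions d t S x h) \<le> 8 * L * M}
    \<le> measure_pmf.prob (replicate_pmf L (pmf_of_set H))
      {hs. ennreal (real (8 * L * M)) \<le> (\<Sum>h\<leftarrow>hs. of_nat (far_collisions d t S x h))}"
    unfolding 3 4 by (intro measure_pmf.finite_measure_mono) auto
  with 2 show ?thesis by linarith
qed

text \<open>All pairs share the same function and may collide together, so nothing is independent
  within a repetition. Dividing by the number of pairs confines one repetition to \<open>Z\<close>
  in [0, 1] with mean at most \<open>p1\<close>, and only the \<open>K * L\<close> draws need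
  independence. The expectation of exp Z is at most 1 + 2 p1, hence at most exp (2 p1); the product
  over all draws is at most exp (6 K) in expectation, and Markov's inequality at exp u
  finishes.\<close>

lemma prob_mid_collisions:
  fixes H :: "('a \<Rightarrow> 'v) set"
  assumes fin: "finite R" "finite S"
    and p1: "\<And>x y. x \<in> R \<Longrightarrow> y \<in> S \<Longrightarrow> r < d x y \<Longrightarrow> collision_prob H x y \<le> p1"
    and p1_nonneg: "0 \<le> p1" and "p1 * real L \<le> 3"
  shows "measure_pmf.prob (replicate_pmf K (replicate_pmf L (pmf_of_set H)))
    {hss. \<not> real (\<Sum>hs\<leftarrow>hss. \<Sum>h\<leftarrow>hs. mid_collisions d r t R S h) \<le> real (card (mid_pairs d r t R S)) * u}
    \<le> exp (6 * real K - u)"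
proof -
  let ?P = "mid_pairs d r t R S"
  have finP: "finite ?P"
    using fin by (auto simp: mid_pairs_def intro: finite_subset[of _ "R \<times> S"])
  define Z where "Z h = real (mid_collisions d r t R S h) / real (card ?P)" for h :: "'a \<Rightarrow> 'v"
  have le: "mid_collisions d r t R S h \<le> card ?P" for h :: "'a \<Rightarrow> 'v"
    unfolding mid_collisions_def using finP by (intro card_mono) auto
  have Z01: "0 \<le> Z h" "Z h \<le> 1" for h
    using le[of h] by (auto simp: Z_def divide_le_eq_1)
  \<comment> \<open>Without such pairs both sides are 0.\<close>
  have mid: "real (mid_collisions d r t R S h) = real (card ?P) * Z h" for h
    using le[of h] by (cases "card ?P = 0") (auto simp: Z_def)
  have "(\<integral>\<^sup>+h. of_nat (mid_collisions d r t R S h) \<partial>measure_pmf (pmf_of_set H))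
      = ennreal (\<Sum>p\<in>?P. collision_prob H (fst p) (snd p))"
    unfolding mid_collisions_def
    by (subst nn_integral_card_pmf[OF finP]) (simp add: collision_prob_def)
  also have "(\<Sum>p\<in>?P. collision_prob H (fst p) (snd p)) \<le> real (card ?P) * p1"
    using p1 by (intro sum_bounded_above) (auto simp: mid_pairs_def)
  finally have mean: "(\<integral>\<^sup>+h. of_nat (mid_collisions d r t R S h) \<partial>measure_pmf (pmf_of_set H))
      \<le> ennreal (real (card ?P) * p1)" by (simp add: ennreal_leI)
  have EZ: "(\<integral>\<^sup>+h. ennreal (Z h) \<partial>measure_pmf (pmf_of_set H)) \<le> ennreal p1"
  proof (cases "card ?P = 0")
    case True
    then show ?thesis by (simp add: Z_def)
  next
    case False
    have "(\<integral>\<^sup>+h. ennreal (Z h) \<partial>measure_pmf (pmf_of_set H))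
       = (\<integral>\<^sup>+h. ennreal (1 / real (card ?P)) * of_nat (mid_collisions d r t R S h) \<partial>measure_pmf (pmf_of_set H))"
      by (intro nn_integral_cong) (simp add: Z_def ennreal_of_nat_eq_real_of_nat flip: ennreal_mult)
    also have "\<dots> \<le> ennreal (1 / real (card ?P)) * ennreal (real (card ?P) * p1)"
      by (subst nn_integral_cmult) (auto intro!: mult_left_mono mean)
    also have "\<dots> = ennreal p1"
      using False p1_nonneg by (simp flip: ennreal_mult)
    finally show ?thesis .
  qed
  have "(\<integral>\<^sup>+h. ennreal (exp (Z h)) \<partial>measure_pmf (pmf_of_set H))
      \<le> (\<integral>\<^sup>+h. 1 + 2 * ennreal (Z h) \<partial>measure_pmf (pmf_of_set H))"
  proof (intro nn_integral_mono)
    fix h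
    have "exp (Z h) \<le> 1 + Z h + (Z h)\<^sup>2" using Z01 by (intro exp_bound)
    also have "(Z h)\<^sup>2 \<le> Z h" using Z01 by (simp add: power2_eq_square mult_left_le)
    finally have "ennreal (exp (Z h)) \<le> ennreal (1 + 2 * Z h)" by (simp add: ennreal_leI)
    also have "\<dots> = 1 + 2 * ennreal (Z h)" using Z01 by (simp add: ennreal_plus ennreal_mult)
    finally show "ennreal (exp (Z h)) \<le> 1 + 2 * ennreal (Z h)" .
  qed
  also have "\<dots> = 1 + 2 * (\<integral>\<^sup>+h. ennreal (Z h) \<partial>measure_pmf (pmf_of_set H))"
    by (simp add: nn_integral_add nn_integral_cmult measure_pmf.emeasure_space_1)
  also have "\<dots> \<le> 1 + 2 * ennreal p1"
    by (intro add_left_mono mult_left_mono EZ) simp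
  also have "\<dots> = ennreal (1 + 2 * p1)"
    using p1_nonneg by (simp add: ennreal_plus ennreal_mult)
  also have "\<dots> \<le> ennreal (exp (2 * p1))" by (intro ennreal_leI exp_ge_add_one_self)
  finally have mgf: "(\<integral>\<^sup>+h. ennreal (exp (Z h)) \<partial>measure_pmf (pmf_of_set H)) \<le> ennreal (exp (2 * p1))" .
  define W where "W hss = (\<Prod>hs\<leftarrow>hss. \<Prod>h\<leftarrow>hs. ennreal (exp (Z h)))" for hss
  have "(\<integral>\<^sup>+hss. W hss \<partial>measure_pmf (replicate_pmf K (replicate_pmf L (pmf_of_set H))))
      \<le> (ennreal (exp (2 * p1)) ^ L) ^ K"
    unfolding W_def nn_integral_replicate_pmf_prod by (intro power_mono mgf) simp_all
  also have "\<dots> = ennreal (exp (2 * (p1 * real L) * real K))"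
    by (simp add: ennreal_power mult_ac flip: exp_of_nat_mult)
  also have "\<dots> \<le> ennreal (exp (6 * real K))"
    using assms(5) by (intro ennreal_leI) (simp add: mult_right_mono)
  finally have "measure_pmf.prob (replicate_pmf K (replicate_pmf L (pmf_of_set H)))
      {hss. ennreal (exp u) \<le> W hss} \<le> exp (6 * real K) / exp u"
    by (intro pmf_markov) simp_all
  moreover have "{hss. \<not> real (\<Sum>hs\<leftarrow>hss. \<Sum>h\<leftarrow>hs. mid_collisions d r t R S h) \<le> real (card ?P) * u}
      \<subseteq> {hss. ennreal (exp u) \<le> W hss}"
  proof safe
    fix hss :: "('a \<Rightarrow> 'v) list list" assume *: "\<not> real (\<Sum>hs\<leftarrow>hss. \<Sum>h\<leftarrow>hs. mid_collisions d r t R S h) \<le> real (card ?P) * u"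
    have s1: "real (\<Sum>h\<leftarrow>hs. mid_collisions d r t R S h) = real (card ?P) * (\<Sum>h\<leftarrow>hs. Z h)" for hs
      by (induction hs) (simp_all add: mid distrib_left)
    have "real (\<Sum>hs\<leftarrow>hss. \<Sum>h\<leftarrow>hs. mid_collisions d r t R S h) = real (card ?P) * (\<Sum>hs\<leftarrow>hss. \<Sum>h\<leftarrow>hs. Z h)"
      by (induction hss) (simp_all add: s1 distrib_left)
    with * have "real (card ?P) * u < real (card ?P) * (\<Sum>hs\<leftarrow>hss. \<Sum>h\<leftarrow>hs. Z h)" by simp
    then have "u \<le> (\<Sum>hs\<leftarrow>hss. \<Sum>h\<leftarrow>hs. Z h)"
      by (metis less_le_not_le mult_left_mono nle_le of_nat_0_le_iff)
    then have "ennreal (exp u) \<le> ennreal (exp (\<Sum>hs\<leftarrow>hss. \<Sum>h\<leftarrow>hs. Z h))"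
      by (intro ennreal_leI) simp
    also have "\<dots> = W hss"
    proof -
      have w1: "ennreal (exp (\<Sum>h\<leftarrow>hs. Z h)) = (\<Prod>h\<leftarrow>hs. ennreal (exp (Z h)))" for hs
        by (induction hs) (simp_all add: exp_add ennreal_mult)
      show ?thesis
        unfolding W_def by (induction hss) (simp_all add: exp_add ennreal_mult w1)
    qed
    finally show "ennreal (exp u) \<le> W hss" .
  qed
  then have "measure_pmf.prob (replicate_pmf K (replicate_pmf L (pmf_of_set H)))
      {hss. \<not> real (\<Sum>hs\<leftarrow>hss. \<Sum>h\<leftarrow>hs. mid_collisions d r t R S h) \<le> real (card ?P) * u}
    \<le> measure_pmf.prob (replicate_pmf K (replicate_pmf L (pmf_of_set H))) {hss. ennreal (exp u) \<le> W hss}"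
    by (intro measure_pmf.finite_measure_mono) simp_all
  ultimately show ?thesis by (simp add: exp_diff)
qed

lemma prob_Un_le:
  "measure_pmf.prob p A \<le> a \<Longrightarrow> measure_pmf.prob p A' \<le> b \<Longrightarrow> measure_pmf.prob p (A \<union> A') \<le> a + b"
  using measure_Un_le[of A "measure_pmf p" A'] by simp

lemma collision_prob_commute: "collision_prob H x y = collision_prob H y x"
  unfolding collision_prob_def by (metis (no_types, lifting))

text \<open>A sufficient condition for a round to report the pair, in terms of its functions only.
  These events are independent over the rounds although the machine state is passed on.\<close>

definition round_succeeds ::
  "('a \<Rightarrow> 'a \<Rightarrow> real) \<Rightarrow> real \<Rightarrow> nat \<Rightarrow> 'a set \<Rightarrow> 'a set \<Rightarrow> 'a \<Rightarrow> 'a \<Rightarrow> ('a \<Rightarrow> 'v) list \<Rightarrow> bool" where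
  "round_succeeds d t T R S x y hs \<longleftrightarrow> (\<exists>h \<in> set hs. h x = h y) \<and>
     (\<Sum>h\<leftarrow>hs. far_collisions d t S x h) \<le> T \<and>
     (\<Sum>h\<leftarrow>hs. far_collisions (\<lambda>y x. d x y) t R y h) \<le> T"

lemma prob_round_fails:
  fixes H :: "('a \<Rightarrow> 'v) set"
  assumes fin: "finite R" "finite S" and xy: "x \<in> R" "y \<in> S"
    and p1: "p1 \<le> collision_prob H x y" "0 < p1" "2 \<le> p1 * real L"
    and p2: "\<And>x y. x \<in> R \<Longrightarrow> y \<in> S \<Longrightarrow> t < d x y \<Longrightarrow> collision_prob H x y \<le> p2" "0 \<le> p2"
    and M: "real (card R + card S) * p2 \<le> real M" "0 < M"
  shows "measure_pmf.prob (replicate_pmf L (pmf_of_set H))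
    {hs. \<not> round_succeeds d t (8 * L * M) R S x y hs} \<le> 1 / 2"
proof -
  have L: "0 < L" using p1 by (cases L) auto
  have "measure_pmf.prob (pmf_of_set H) {h. h x \<noteq> h y} = 1 - collision_prob H x y"
    unfolding collision_prob_def
    using measure_pmf.prob_compl[of "{h. h x = h y}" "pmf_of_set H"] by (simp add: Compl_eq_Diff_UNIV[symmetric] Collect_neg_eq)
  then have "measure_pmf.prob (replicate_pmf L (pmf_of_set H)) {hs. \<forall>h \<in> set hs. h x \<noteq> h y}
      = (1 - collision_prob H x y) ^ L"
    by (simp add: prob_replicate_pmf_all)
  also have "\<dots> \<le> exp (- p1) ^ L"
  proof (intro power_mono)
    show "1 - collision_prob H x y \<le> exp (- p1)"
      using p1 exp_ge_add_one_self[of "- p1"] by linarith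
    show "0 \<le> 1 - collision_prob H x y"
      by (simp add: collision_prob_def)
  qed
  also have "\<dots> = exp (- (p1 * real L))" by (simp add: mult.commute flip: exp_of_nat_mult)
  also have "\<dots> \<le> exp (- 2)" using p1 by simp
  also have "\<dots> \<le> 1 / (4 :: real)"
  proof -
    have "(2::real) * 2 \<le> exp 1 * exp 1"
      using exp_ge_add_one_self[of "1::real"] by (intro mult_mono) simp_all
    then show ?thesis by (simp add: exp_minus field_simps flip: exp_add)
  qed
  finally have 1: "measure_pmf.prob (replicate_pmf L (pmf_of_set H)) {hs. \<forall>h \<in> set hs. h x \<noteq> h y} \<le> 1 / 4" .
  have "real (card S) * p2 \<le> real (card R + card S) * p2" "real (card R) * p2 \<le> real (card R + card S) * p2"
    using p2(2) by (simp_all add: mult_right_mono)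
  with M have M': "real (card S) * p2 \<le> real M" "real (card R) * p2 \<le> real M" by linarith+
  have 2: "measure_pmf.prob (replicate_pmf L (pmf_of_set H))
      {hs. \<not> (\<Sum>h\<leftarrow>hs. far_collisions d t S x h) \<le> 8 * L * M} \<le> 1 / 8"
    using fin xy p2 M' M L by (intro prob_far_collisions[where ?p2.0 = p2]) auto
  have 3: "measure_pmf.prob (replicate_pmf L (pmf_of_set H))
      {hs. \<not> (\<Sum>h\<leftarrow>hs. far_collisions (\<lambda>y x. d x y) t R y h) \<le> 8 * L * M} \<le> 1 / 8"
    using fin xy p2 M' M L
    by (intro prob_far_collisions[where ?p2.0 = p2]) (auto simp: collision_prob_commute[of H y])
  have eq: "{hs. \<not> round_succeeds d t (8 * L * M) R S x y hs} = {hs. \<forall>h \<in> set hs. h x \<noteq> h y} \<union>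
      ({hs. \<not> (\<Sum>h\<leftarrow>hs. far_collisions d t S x h) \<le> 8 * L * M} \<union>
      {hs. \<not> (\<Sum>h\<leftarrow>hs. far_collisions (\<lambda>y x. d x y) t R y h) \<le> 8 * L * M})"
    by (auto simp: round_succeeds_def)
  show ?thesis
    unfolding eq using prob_Un_le[OF 1 prob_Un_le[OF 2 3]] by linarith
qed

section \<open>Arithmetic of the final bound\<close>

text \<open>\<open>l\<close> stands for ln N and \<open>q\<close> for (N/M)^\<rho> = 1/p1;
  \<open>J\<close>, \<open>G\<close> and \<open>J'\<close> count the near pairs, those between
  \<open>r\<close> and \<open>c * r\<close>, and all up to \<open>c * r\<close>. One factor
  \<open>l\<close> comes from the number of rounds, the other from the depth of the sort; the
  remaining terms are rounded up to \<open>l ^ 2\<close>.\<close>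

lemma io_bound:
  fixes M B N L K D J G J' ios W :: nat and l q :: real
  defines "m \<equiv> M div 2"
  assumes B: "0 < B" "2 * B \<le> M"
    and l: "1 \<le> l" "real K \<le> 6 * l" "real (D + 1) \<le> 4 * l"
    and q: "1 \<le> q" "real L \<le> 3 * q"
    and ios: "m * B * ios \<le> K * (9 * m * N + L * (39 * m * N * (D + 1)) + 6 * (N * (8 * L * M + m) + L * J)) + 6 * W"
    and W: "real W \<le> real G * (38 * l)" "G \<le> J'"
  shows "real ios \<le> 6000 * l ^ 2 * (q * (real N / real B + real J / (real M * real B)) + real J' / (real M * real B))"
proof -
  have m: "M \<le> 3 * m" "0 < m" using B by (auto simp: m_def)
  have ql: "1 \<le> q * l" "q \<le> q * l" "0 \<le> q" "0 \<le> l" using l q mult_mono[of 1 q 1 l] by auto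
  let ?n = "real m * real N"
  have n: "0 \<le> ?n" by simp
  have "real L * real (D + 1) \<le> (3 * q) * (4 * l)"
    using q l ql by (intro mult_mono) auto
  then have a: "39 * (?n * (real L * real (D + 1))) \<le> 39 * (?n * (12 * (q * l)))"
    by (intro mult_left_mono) auto
  have "real M * real L \<le> (3 * real m) * (3 * q)"
    using m q ql by (intro mult_mono) auto
  then have "48 * (real N * (real M * real L)) \<le> 48 * (real N * ((3 * real m) * (3 * q)))"
    by (intro mult_left_mono) auto
  then have b: "48 * (real N * (real M * real L)) \<le> 432 * (?n * q)" by simp
  have b': "432 * (?n * q) \<le> 432 * (?n * (q * l))" using ql n by (intro mult_left_mono) auto
  have e: "15 * ?n \<le> 15 * (?n * (q * l))" using ql n mult_left_mono[of 1 "q * l" ?n] by simp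
  have "real L \<le> 3 * (q * l)" using q ql by linarith
  then have "real L * real J \<le> 3 * (q * l) * real J" by (rule mult_right_mono) simp
  moreover have "3 * (q * l) * real J = 3 * (q * l * real J)" by simp
  ultimately have f: "6 * (real L * real J) \<le> 18 * (q * l * real J)" by linarith
  define X where "X = 9 * ?n + 39 * (?n * (real L * real (D + 1))) + 48 * (real N * (real M * real L)) + 6 * ?n + 6 * (real L * real J)"
  \<comment> \<open>915 is 9 + 39 * 12 + 432 + 6.\<close>
  have X: "X \<le> 915 * (?n * (q * l)) + 18 * (q * l * real J)"
    unfolding X_def using a b b' e f by linarith
  have "0 \<le> X" by (simp add: X_def)
  have W': "real W \<le> 38 * (l * l * real J')"
  proof -
    have "real G * (38 * l) \<le> real J' * (38 * (l * l))"
      using W(2) l ql mult_left_mono[of 1 l l] by (intro mult_mono) auto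
    then show ?thesis using W(1) by (simp add: mult_ac)
  qed
  have "real (m * B * ios) \<le> real K * X + 6 * real W"
    using of_nat_mono[OF ios, where 'a = real] by (simp add: X_def algebra_simps)
  also have "\<dots> \<le> (6 * l) * (915 * (?n * (q * l)) + 18 * (q * l * real J)) + 6 * (38 * (l * l * real J'))"
    using l X W' \<open>0 \<le> X\<close> by (intro add_mono mult_mono) auto
  also have "\<dots> = 5490 * (l ^ 2 * q * ?n) + 108 * (l ^ 2 * q * real J) + 228 * (l ^ 2 * real J')"
    by (simp add: power2_eq_square algebra_simps)
  \<comment> \<open>Division by \<open>m * B\<close> will leave 1/m in the last two terms, where 1/M
    is wanted. As \<open>M \<le> 3 * m\<close>, the change costs a factor 3, for which 2000 leaves
    room below 6000.\<close>
  also have "\<dots> \<le> 6000 * (l ^ 2 * q * ?n) + 2000 * (l ^ 2 * q * real J) + 2000 * (l ^ 2 * real J')"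
    using ql by (intro add_mono mult_right_mono) auto
  finally have up: "real m * real B * real ios \<le> \<dots>" by simp
  have "real M \<le> 3 * real m" using m by linarith
  then have mM: "1 \<le> 3 * (real m / real M)" using B by simp
  have "2000 * (l ^ 2 * q * real J) \<le> 2000 * (l ^ 2 * q * real J) * (3 * (real m / real M))"
    "2000 * (l ^ 2 * real J') \<le> 2000 * (l ^ 2 * real J') * (3 * (real m / real M))"
    using mult_left_mono[OF mM, of "2000 * (l ^ 2 * q * real J)"]
      mult_left_mono[OF mM, of "2000 * (l ^ 2 * real J')"] ql by simp_all
  with up have "real m * real B * real ios \<le> 6000 * (l ^ 2 * q * ?n)
      + 2000 * (l ^ 2 * q * real J) * (3 * (real m / real M)) + 2000 * (l ^ 2 * real J') * (3 * (real m / real M))"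
    by linarith
  also have "\<dots> = (real m * real B) * (6000 * l ^ 2 * (q * (real N / real B + real J / (real M * real B)) + real J' / (real M * real B)))"
    using B by (simp add: field_simps)
  finally show ?thesis
    using m B by (subst (asm) mult_le_cancel_left_pos) simp_all
qed

section \<open>The bound with high probability\<close>

lemma asimjoin_high_probability:
  fixes d :: "'a \<Rightarrow> 'a \<Rightarrow> real" and H :: "('a \<Rightarrow> 'v::linorder) set"
  assumes R: "distinct xs" "set xs = R" and S: "distinct ys" "set ys = S" and U: "R \<subseteq> U" "S \<subseteq> U"
    and d: "distance_function U d" and r: "0 < r"
    and N: "N = card R + card S" "3 \<le> N" and B: "1 \<le> B" "2 * B \<le> M"
    and rho: "0 < \<rho>" and p1_def: "p1 = (real M / real N) powr \<rho>" and p2_def: "p2 = real M / real N"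
    and sens: "sensitive U d H r (c * r) p1 p2" and thr: "threshold_prob U d H r p1"
  shows "measure_pmf.prob (asimjoin d r c M B H p1 xs ys)
        {s. emitted s = sim_join d r R S \<and>
            real (ios s) \<le> 6000 * ln (real N) ^ 2 *
              ((real N / real M) powr \<rho> *
                 (real N / real B + real (card (sim_join d r R S)) / (real M * real B))
               + real (card (sim_join d (c * r) R S)) / (real M * real B))}
      \<ge> 1 - 1 / real N"
proof -
  have fin: "finite R" "finite S" using R S by auto
  have len: "length xs + length ys = N"
    using R S N by (metis distinct_card)
  have M: "0 < M" "2 \<le> M" using B by auto
  have p1_pos: "0 < p1" using M N by (simp add: p1_def)
  \<comment> \<open>A point is at distance 0 from itself, so sensitivity forces
    \<open>p1 \<le> 1\<close>, and with \<open>0 < \<rho>\<close> this gives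
    \<open>M \<le> N\<close>.\<close>
  have "R \<union> S \<noteq> {}" using N by auto
  then obtain z where "z \<in> U" using U by blast
  then have "d z z \<le> r" using d r by (simp add: distance_function_def)
  then have "p1 \<le> collision_prob H z z" using sens \<open>z \<in> U\<close> by (auto simp: sensitive_def)
  then have p1_le: "p1 \<le> 1" by (simp add: collision_prob_def)
  have MN: "M \<le> N"
  proof (rule ccontr)
    assume "\<not> M \<le> N"
    then have "1 < real M / real N" using N by simp
    then have "1 < p1" unfolding p1_def using rho by (intro gr_one_powr) auto
    with p1_le show False by simp
  qed
  define L where "L = nat \<lceil>2 / p1\<rceil>"
  define K where "K = nat \<lceil>3 * log 2 (real N)\<rceil>"
  define D where "D = nat \<lceil>log 2 (real N)\<rceil>"
  define l where "l = ln (real N)"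
  define q where "q = (real N / real M) powr \<rho>"
  have qp1: "q = 1 / p1" using M N by (simp add: q_def p1_def powr_divide)
  have q1: "1 \<le> q" using p1_pos p1_le by (simp add: qp1)
  have L_ge: "2 / p1 \<le> real L" by (simp add: L_def real_nat_ceiling_ge)
  have "0 < 2 / p1" using p1_pos by simp
  then have "real L \<le> 2 / p1 + 1" unfolding L_def by linarith
  \<comment> \<open>Rounding up adds at most 1, which is at most \<open>q\<close>.\<close>
  then have L_le: "real L \<le> 3 * q" using q1 by (simp add: qp1)
  have p1L: "2 \<le> p1 * real L" using L_ge p1_pos by (simp add: field_simps)
  have p1L3: "p1 * real L \<le> 3"
    using mult_left_mono[OF L_le, of p1] p1_pos by (simp add: qp1)
  have l1: "1 \<le> l"
    using N exp_le unfolding l_def by (subst ln_ge_iff) linarith+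
  have log_pos: "0 \<le> log 2 (real N)" using N by simp
  \<comment> \<open>By ln 2 \<ge> 2/3. With \<open>1 \<le> l\<close> the rounding in
    \<open>K\<close> and \<open>D\<close> is then absorbed by the constants 6 and 4.\<close>
  have log_le: "log 2 (real N) \<le> 3 / 2 * l"
  proof -
    have "log 2 (real N) * ln 2 = l" by (simp add: log_def l_def)
    moreover have "log 2 (real N) * (2 / 3) \<le> log 2 (real N) * ln 2"
      using ln2_ge_two_thirds log_pos by (intro mult_left_mono)
    ultimately show ?thesis by linarith
  qed
  have K_le: "real K \<le> 6 * l" using log_le log_pos l1 unfolding K_def by linarith
  have D_le: "real (D + 1) \<le> 4 * l" using log_le log_pos l1 unfolding D_def by linarith
  have powr_log: "2 powr (log 2 (real N)) = real N" using N by simp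
  have "2 powr (log 2 (real N)) \<le> 2 powr real D"
    unfolding D_def by (intro powr_mono) (simp_all add: real_nat_ceiling_ge)
  then have "real N \<le> real (2 ^ D)" using powr_log by (simp add: powr_realpow)
  then have N2D: "N \<le> 2 ^ D" by (simp only: of_nat_le_iff)
  have "2 powr (3 * log 2 (real N)) \<le> 2 powr real K"
    unfolding K_def by (intro powr_mono) (simp_all add: real_nat_ceiling_ge)
  moreover have "2 powr (3 * log 2 (real N)) = real N ^ 3"
    using powr_log by (metis powr_powr mult.commute powr_numeral of_nat_0_le_iff)
  ultimately have N3: "real N ^ 3 \<le> 2 ^ K" by (simp add: powr_realpow)

  let ?p = "replicate_pmf K (replicate_pmf L (pmf_of_set H))"
  let ?J = "sim_join d r R S" and ?G = "mid_pairs d r (c * r) R S"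
  let ?W = "\<lambda>hss :: ('a \<Rightarrow> 'v) list list. \<Sum>hs\<leftarrow>hss. \<Sum>h\<leftarrow>hs. mid_collisions d r (c * r) R S h"
  \<comment> \<open>The threshold \<open>6 * K + 2 * l\<close> turns the exponent in
    \<open>prob_mid_collisions\<close> into \<open>- 2 * l\<close>, a failure probability of 1/N^2;
    by \<open>K \<le> 6 * l\<close> it is at most \<open>38 * l\<close>.\<close>
  define bad1 where "bad1 = {hss. \<not> real (?W hss) \<le> real (card ?G) * (6 * real K + 2 * l)}"
  define bad2 where "bad2 p = {hss :: ('a \<Rightarrow> 'v) list list. \<forall>hs \<in> set hss. \<not> round_succeeds d (c * r) (8 * L * M) R S (fst p) (snd p) hs}" for p
  have finJ: "finite ?J"
    using fin by (auto simp: sim_join_def intro: finite_subset[of _ "R \<times> S"])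
  have RU: "x \<in> U" if "x \<in> R" for x using U that by blast
  have SU: "x \<in> U" if "x \<in> S" for x using U that by blast
  have bad1: "measure_pmf.prob ?p bad1 \<le> exp (6 * real K - (6 * real K + 2 * l))"
    unfolding bad1_def
  proof (rule prob_mid_collisions[OF fin])
    show "collision_prob H x y \<le> p1" if "x \<in> R" "y \<in> S" "r < d x y" for x y
      using thr that RU SU unfolding threshold_prob_def by blast
  qed (use p1_pos p1L3 in auto)
  have bad2: "measure_pmf.prob ?p (bad2 p) \<le> (1 / 2) ^ K" if "p \<in> ?J" for p
    unfolding bad2_def prob_replicate_pmf_all
  proof (intro power_mono prob_round_fails)
    have p: "fst p \<in> R" "snd p \<in> S" "d (fst p) (snd p) \<le> r" using that by (auto simp: sim_join_def)
    then show "fst p \<in> R" "snd p \<in> S" by simp_all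
    show "p1 \<le> collision_prob H (fst p) (snd p)"
      using sens p RU SU unfolding sensitive_def by blast
    show "collision_prob H x y \<le> p2" if "x \<in> R" "y \<in> S" "c * r < d x y" for x y
      using sens that RU SU unfolding sensitive_def by (meson less_imp_le)
    show "real (card R + card S) * p2 \<le> real M" using N by (simp add: p2_def)
  qed (use fin p1_pos p1L M in \<open>auto simp: p2_def\<close>)
  have "measure_pmf.prob ?p (bad1 \<union> (\<Union>p\<in>?J. bad2 p)) \<le> exp (6 * real K - (6 * real K + 2 * l)) + (\<Sum>p\<in>?J. (1 / 2) ^ K)"
  proof (intro prob_Un_le bad1)
    have "measure_pmf.prob ?p (\<Union>p\<in>?J. bad2 p) \<le> (\<Sum>p\<in>?J. measure_pmf.prob ?p (bad2 p))"
      using finJ by (intro measure_pmf.finite_measure_subadditive_finite) auto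
    also have "\<dots> \<le> (\<Sum>p\<in>?J. (1 / 2) ^ K)" by (intro sum_mono bad2)
    finally show "measure_pmf.prob ?p (\<Union>p\<in>?J. bad2 p) \<le> (\<Sum>p\<in>?J. (1 / 2) ^ K)" .
  qed
  also have "\<dots> \<le> 1 / real N"
  proof -
    have "exp (6 * real K - (6 * real K + 2 * l)) = exp (- (2 * l))" by simp
    also have "\<dots> = 1 / real N ^ 2"
      using N by (simp add: l_def exp_minus exp_double field_simps)
    finally have e: "exp (6 * real K - (6 * real K + 2 * l)) = 1 / real N ^ 2" .
    have "card ?J \<le> card (R \<times> S)" using fin by (intro card_mono) (auto simp: sim_join_def)
    then have "real (card ?J) \<le> real (card R) * real (card S)"
      by (simp add: card_cartesian_product flip: of_nat_mult)
    also have "\<dots> \<le> (real (card R) + real (card S)) ^ 2 / 4"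
      using sum_squares_bound[of "real (card R)" "real (card S)"] by (simp add: power2_eq_square algebra_simps)
    finally have J: "real (card ?J) \<le> real N ^ 2 / 4" by (simp add: N(1))
    have "(\<Sum>p\<in>?J. (1 / 2) ^ K) = real (card ?J) / 2 ^ K" by (simp add: power_one_over)
    also have "\<dots> \<le> (real N ^ 2 / 4) / real N ^ 3"
      using J N3 N by (intro frac_le) auto
    also have "\<dots> = 1 / (4 * real N)" using N by (simp add: power2_eq_square power3_eq_cube)
    finally have s: "(\<Sum>p\<in>?J. (1 / 2) ^ K) \<le> 1 / (4 * real N)" .
    \<comment> \<open>\<open>3 \<le> N\<close> turns 1/N^2 into at most 1/(3 N); together with 1/(4
      N) for the near pairs this stays below 1/N.\<close>
    have "3 * real N \<le> real N ^ 2"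
      unfolding power2_eq_square using N(2) by (intro mult_right_mono) simp_all
    then have "1 / real N ^ 2 \<le> 1 / (3 * real N)"
      using N(2) by (intro divide_left_mono) simp_all
    moreover have "1 / (3 * real N) = (1 / real N) * (1 / 3)" "1 / (4 * real N) = (1 / real N) * (1 / 4)" "0 \<le> 1 / real N" by simp_all
    ultimately show ?thesis using e s by linarith
  qed
  finally have bad: "measure_pmf.prob ?p (bad1 \<union> (\<Union>p\<in>?J. bad2 p)) \<le> 1 / real N" .

  define s0 :: "'a mach" where "s0 = \<lparr>frame = (\<lambda>_ _. None), ios = 0, emitted = {}\<rparr>"
  let ?run = "\<lambda>hss :: ('a \<Rightarrow> 'v) list list. fold (det_round d r c M B (8 * L * M) xs ys) hss s0"
  let ?bound = "6000 * l ^ 2 * (q * (real N / real B + real (card ?J) / (real M * real B))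
               + real (card (sim_join d (c * r) R S)) / (real M * real B))"
  let ?good = "{s. emitted s = ?J \<and> real (ios s) \<le> ?bound}"
  have good: "?run hss \<in> ?good" if hss: "hss \<in> set_pmf ?p" "hss \<notin> bad1" "\<And>p. p \<in> ?J \<Longrightarrow> hss \<notin> bad2 p" for hss
  proof -
    have lens: "length hss = K" "\<forall>hs \<in> set hss. length hs = L"
      using hss(1) by (auto simp: set_replicate_pmf)
    have B0: "0 < B" "2 * B \<le> N" using B MN by simp_all
    note run = fold_det_round_spec[OF B0(1) B(2) R(1) S(1) len B0(2) N2D lens(2), where d = d and r = r and c = c
        and T = "8 * L * M" and s = s0, unfolded R(2) S(2) lens(1)]
    have "?J \<subseteq> emitted (?run hss)"
    proof
      fix p assume p: "p \<in> ?J"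
      obtain x y where xy: "p = (x, y)" by (cases p)
      obtain hs where hs: "hs \<in> set hss" "round_succeeds d (c * r) (8 * L * M) R S x y hs"
        using hss(3)[OF p] xy by (auto simp: bad2_def)
      then show "p \<in> emitted (?run hss)"
        using run p unfolding xy round_succeeds_def by blast
    qed
    moreover have "emitted (?run hss) \<subseteq> ?J"
      using run by (simp add: s0_def)
    moreover have "real (ios (?run hss)) \<le> ?bound"
    proof (rule io_bound[OF B0(1) B(2) l1 K_le D_le q1 L_le])
      show "M div 2 * B * ios (?run hss) \<le> K * (9 * (M div 2) * N + L * (39 * (M div 2) * N * (D + 1))
          + 6 * (N * (8 * L * M + M div 2) + L * card ?J)) + 6 * ?W hss"
        using run by (simp add: s0_def)
      have "real (?W hss) \<le> real (card ?G) * (6 * real K + 2 * l)"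
        using hss(2) by (simp add: bad1_def)
      also have "\<dots> \<le> real (card ?G) * (38 * l)" using K_le by (intro mult_left_mono) auto
      finally show "real (?W hss) \<le> real (card ?G) * (38 * l)" .
      show "card ?G \<le> card (sim_join d (c * r) R S)"
        by (intro card_mono finite_subset[of "sim_join d (c * r) R S" "R \<times> S"])
          (use fin in \<open>auto simp: sim_join_def mid_pairs_def\<close>)
    qed
    ultimately show ?thesis by simp
  qed
  have "1 - 1 / real N \<le> 1 - measure_pmf.prob ?p (bad1 \<union> (\<Union>p\<in>?J. bad2 p))"
    using bad by simp
  also have "\<dots> = measure_pmf.prob ?p (UNIV - (bad1 \<union> (\<Union>p\<in>?J. bad2 p)))"
    using measure_pmf.prob_compl[of "bad1 \<union> (\<Union>p\<in>?J. bad2 p)" ?p] by simp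
  \<comment> \<open>Only on the support are the lists known to have the lengths \<open>K\<close> and
    \<open>L\<close>.\<close>
  also have "\<dots> = measure_pmf.prob ?p ((UNIV - (bad1 \<union> (\<Union>p\<in>?J. bad2 p))) \<inter> set_pmf ?p)"
    by (rule measure_Int_set_pmf[symmetric])
  also have "\<dots> \<le> measure_pmf.prob ?p (?run -` ?good)"
  proof (intro measure_pmf.finite_measure_mono subsetI)
    fix hss assume "hss \<in> (UNIV - (bad1 \<union> (\<Union>p\<in>?J. bad2 p))) \<inter> set_pmf ?p"
    then show "hss \<in> ?run -` ?good"
      unfolding vimage_eq by (intro good) blast+
  qed simp
  also have "\<dots> = measure_pmf.prob (asimjoin d r c M B H p1 xs ys) ?good"
    unfolding asimjoin_eq len L_def[symmetric] K_def[symmetric] s0_def[symmetric] by simp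
  finally show ?thesis unfolding l_def q_def .
qed

theorem theorem3:
  shows "\<exists>C > (0::real). \<exists>k N0 :: nat.
    \<forall>(U :: 'a set) (d :: 'a \<Rightarrow> 'a \<Rightarrow> real) (r :: real) (c :: real) (\<rho> :: real)
      (R :: 'a set) (S :: 'a set) (xs :: 'a list) (ys :: 'a list)
      (M :: nat) (B :: nat) (N :: nat) (H :: ('a \<Rightarrow> 'v::linorder) set) (p1 :: real) (p2 :: real).
      distance_function U d \<and> 0 < r \<and> 1 < c \<and>
      finite R \<and> finite S \<and> R \<subseteq> U \<and> S \<subseteq> U \<and>
      distinct xs \<and> set xs = R \<and> distinct ys \<and> set ys = S \<and>
      N = card R + card S \<and> N0 \<le> N \<and>
      1 \<le> B \<and> 2 * B \<le> M \<and>
      0 < \<rho> \<and> \<rho> < 1 \<and> p1 = (real M / real N) powr \<rho> \<and> p2 = real M / real N \<and>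
      finite H \<and> H \<noteq> {} \<and>
      sensitive U d H r (c * r) p1 p2 \<and> monotonic U d H \<and> threshold_prob U d H r p1
      \<longrightarrow>
      measure_pmf.prob (asimjoin d r c M B H p1 xs ys)
        {s. emitted s = sim_join d r R S \<and>
            real (ios s) \<le> C * ln (real N) ^ k *
              ((real N / real M) powr \<rho> *
                 (real N / real B + real (card (sim_join d r R S)) / (real M * real B))
               + real (card (sim_join d (c * r) R S)) / (real M * real B))}
      \<ge> 1 - 1 / real N"
\<comment> \<open>The constant and the exponent 2 are those of \<open>io_bound\<close>; the lower
  bound 3 for N ensures ln N \<ge> 1.\<close>
proof (intro exI[of _ "6000::real"] conjI)
  show "(0::real) < 6000" by simp
qed (rule exI[of _ 2], rule exI[of _ 3], intro allI impI, elim conjE, rule asimjoin_high_probability; assumption)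

end
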